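(* Let $f:(\mathbb{R}^2,\mathbf{0})\to(\mathbb{R}^3,\mathbf{0})$ be a $D_4^+$ singularity, with unit normal vector field $\nu$, and let $\gamma:((-\varepsilon,\varepsilon),0)\to(\mathbb{R}^2,\mathbf{0})$ be a regular curve whose image is contained in the set of singular points $S(f)$ of $f$ (for small $t\neq0$ the points $\gamma(t)$ are then cuspidal edges of $f$). Set $\hat\gamma(t)=f(\gamma(t))$. If $$\det\big(\hat\gamma''(0),\hat\gamma'''(0),\nu(\mathbf{0})\big)\neq0,$$ then the singular curvature $\kappa_s(t)$ of $\gamma(t)$ diverges as $\gamma(t)$ approaches $\gamma(0)$ from both sides, and it diverges with opposite signs on opposite sides; that is, one of the limits $\lim_{t\to+0}\kappa_s(t)$, $\lim_{t\to-0}\kappa_s(t)$ is $+\infty$ and the other is $-\infty$.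
   Context: All maps are of class $C^\infty$. A map-germ $f:(\mathbb{R}^2,\mathbf{0})\to(\mathbb{R}^3,\mathbf{0})$ is a front if there is a unit vector field $\nu$ along $f$ such that $\langle df(X_p),\nu(p)\rangle=0$ for all tangent vectors $X_p$ and $(f,\nu):\mathbb{R}^2\to\mathbb{R}^3\times S^2$ is an immersion near $\mathbf{0}$; $\nu$ is called the unit normal vector field of $f$. A $D_4^+$ singularity is a map-germ right-left equivalent to $(u,v)\mapsto(uv,u^2+3v^2,u^2v+v^3)$ at $\mathbf{0}$ (it is a front), and a cuspidal edge is a map-germ right-left equivalent to $(u,v)\mapsto(u,v^2,v^3)$ at $\mathbf{0}$. Here $f_1,f_2$ are right-left equivalent if $f_2\circ S=T\circ f_1$ for some diffeomorphism-germs $S$ of the source and $T$ of the target fixing the origins. Put $\lambda(u,v)=\det(f_u,f_v,\nu)$. The set of singular points $S(f)$ is the set of points where $\operatorname{rank} df<2$, which coincides with the zero set of $\lambda$. Singular curvature: let $\gamma(t)$ be a regular curve in the source parametrizing singular points of $f$ which are cuspidal edges, and let $\eta(t)$ be a non-vanishing vector field along $\gamma(t)$ such that $\eta(t)\in\ker df_{\gamma(t)}$ and $(\gamma'(t),\eta(t))$ is a positively oriented frame of $\mathbb{R}^2$. With $\hat\gamma(t)=f(\gamma(t))$ and ${}'=d/dt$, the singular curvature of the cuspidal edge $\gamma(t)$ is $$\kappa_s(t)=\operatorname{sgn}\big(d\lambda(\eta(t))\big)\,\frac{\det\big(\hat\gamma'(t),\hat\gamma''(t),\nu(\gamma(t))\big)}{|\hat\gamma'(t)|^3}.$$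 *)

theory Defs
  imports "HOL-Analysis.Analysis"
begin

(* Meant for open S: being C^k on S is characterized by recursion through all
   directional derivatives, which in finite dimension is the usual notion. *)
primrec Ck_on :: "nat \<Rightarrow> 'a::euclidean_space set \<Rightarrow> ('a \<Rightarrow> 'b::real_normed_vector) \<Rightarrow> bool" where
  "Ck_on 0 S f \<longleftrightarrow> continuous_on S f"
| "Ck_on (Suc k) S f \<longleftrightarrow>
     (\<forall>x\<in>S. f differentiable (at x)) \<and> (\<forall>v. Ck_on k S (\<lambda>x. frechet_derivative f (at x) v))"

definition smooth_on :: "'a::euclidean_space set \<Rightarrow> ('a \<Rightarrow> 'b::real_normed_vector) \<Rightarrow> bool" where
  "smooth_on S f \<longleftrightarrow> (\<forall>k. Ck_on k S f)"

(* A germ is represented by a total function; only its values near 0 matter. *)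
definition map_germ :: "('a::euclidean_space \<Rightarrow> 'b::euclidean_space) \<Rightarrow> bool" where
  "map_germ f \<longleftrightarrow> f 0 = 0 \<and> (\<exists>U. open U \<and> 0 \<in> U \<and> smooth_on U f)"

definition diffeo_germ :: "('a::euclidean_space \<Rightarrow> 'a) \<Rightarrow> bool" where
  "diffeo_germ S \<longleftrightarrow> S 0 = 0 \<and>
     (\<exists>U V S'. open U \<and> open V \<and> 0 \<in> U \<and> homeomorphism U V S S' \<and> smooth_on U S \<and> smooth_on V S')"

definition right_left_equivalent ::
    "('a::euclidean_space \<Rightarrow> 'b::euclidean_space) \<Rightarrow> ('a \<Rightarrow> 'b) \<Rightarrow> bool" where
  "right_left_equivalent f1 f2 \<longleftrightarrow>
     (\<exists>S T. diffeo_germ S \<and> diffeo_germ T \<and> (\<forall>\<^sub>F x in nhds 0. f2 (S x) = T (f1 x)))"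

definition D4_plus_normal_form :: "real^2 \<Rightarrow> real^3" where
  "D4_plus_normal_form x =
     vector [x$1 * x$2, (x$1)\<^sup>2 + 3 * (x$2)\<^sup>2, (x$1)\<^sup>2 * x$2 + (x$2)^3]"

definition cuspidal_edge_normal_form :: "real^2 \<Rightarrow> real^3" where
  "cuspidal_edge_normal_form x = vector [x$1, (x$2)\<^sup>2, (x$2)^3]"

definition D4_plus :: "(real^2 \<Rightarrow> real^3) \<Rightarrow> bool" where
  "D4_plus f \<longleftrightarrow> map_germ f \<and> right_left_equivalent f D4_plus_normal_form"

definition cuspidal_edge_at :: "(real^2 \<Rightarrow> real^3) \<Rightarrow> real^2 \<Rightarrow> bool" where
  "cuspidal_edge_at f p \<longleftrightarrow>
     map_germ (\<lambda>x. f (p + x) - f p) \<and>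
     right_left_equivalent (\<lambda>x. f (p + x) - f p) cuspidal_edge_normal_form"

definition front_with_normal :: "(real^2 \<Rightarrow> real^3) \<Rightarrow> (real^2 \<Rightarrow> real^3) \<Rightarrow> bool" where
  "front_with_normal f \<nu> \<longleftrightarrow>
     (\<exists>U. open U \<and> 0 \<in> U \<and> smooth_on U f \<and> smooth_on U \<nu> \<and>
       (\<forall>p\<in>U. norm (\<nu> p) = 1 \<and>
              (\<forall>X. frechet_derivative f (at p) X \<bullet> \<nu> p = 0) \<and>
              inj (frechet_derivative (\<lambda>q. (f q, \<nu> q)) (at p))))"

definition singular_set :: "(real^2 \<Rightarrow> real^3) \<Rightarrow> (real^2) set" where
  "singular_set f = {p. f differentiable (at p) \<and> rank (jacobian f (at p)) < 2}"

definition det2 :: "real^2 \<Rightarrow> real^2 \<Rightarrow> real" where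
  "det2 a b = det (vector [a, b] :: real^2^2)"

definition det3 :: "real^3 \<Rightarrow> real^3 \<Rightarrow> real^3 \<Rightarrow> real" where
  "det3 a b c = det (vector [a, b, c] :: real^3^3)"

definition signed_area_density :: "(real^2 \<Rightarrow> real^3) \<Rightarrow> (real^2 \<Rightarrow> real^3) \<Rightarrow> real^2 \<Rightarrow> real" where
  "signed_area_density f \<nu> p =
     det3 (frechet_derivative f (at p) (axis 1 1)) (frechet_derivative f (at p) (axis 2 1)) (\<nu> p)"

definition vderiv :: "(real \<Rightarrow> 'a::real_normed_vector) \<Rightarrow> real \<Rightarrow> 'a" where
  "vderiv c t = vector_derivative c (at t)"

definition null_field_along ::
    "(real^2 \<Rightarrow> real^3) \<Rightarrow> (real \<Rightarrow> real^2) \<Rightarrow> real set \<Rightarrow> (real \<Rightarrow> real^2) \<Rightarrow> bool" where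
  "null_field_along f \<gamma> J \<eta> \<longleftrightarrow> smooth_on J \<eta> \<and>
     (\<forall>t\<in>J. \<eta> t \<noteq> 0 \<and> frechet_derivative f (at (\<gamma> t)) (\<eta> t) = 0 \<and> det2 (vderiv \<gamma> t) (\<eta> t) > 0)"

definition singular_curvature_wrt ::
    "(real^2 \<Rightarrow> real^3) \<Rightarrow> (real^2 \<Rightarrow> real^3) \<Rightarrow> (real \<Rightarrow> real^2) \<Rightarrow> (real \<Rightarrow> real^2) \<Rightarrow> real \<Rightarrow> real" where
  "singular_curvature_wrt f \<nu> \<gamma> \<eta> t =
     sgn (frechet_derivative (signed_area_density f \<nu>) (at (\<gamma> t)) (\<eta> t)) *
     (det3 (vderiv (f \<circ> \<gamma>) t) ((vderiv ^^ 2) (f \<circ> \<gamma>) t) (\<nu> (\<gamma> t)) / norm (vderiv (f \<circ> \<gamma>) t) ^ 3)"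

(* The value does not depend on the null field: at a cuspidal edge the kernel of df is a line
   transversal to the singular curve, so eta t is determined up to a positive factor. *)
definition singular_curvature ::
    "(real^2 \<Rightarrow> real^3) \<Rightarrow> (real^2 \<Rightarrow> real^3) \<Rightarrow> (real \<Rightarrow> real^2) \<Rightarrow> real \<Rightarrow> real" where
  "singular_curvature f \<nu> \<gamma> t =
     (THE k. \<exists>J \<eta>. open J \<and> t \<in> J \<and> null_field_along f \<gamma> J \<eta> \<and>
                   k = singular_curvature_wrt f \<nu> \<gamma> \<eta> t)"

end

theory Submission
  imports Defs
begin

text \<open>After linear changes of coordinates the normal form becomes
  \<open>h(a, b) = (a\<^sup>2, b\<^sup>2, a\<^sup>3 - b\<^sup>3)\<close>, so \<open>f = \<Psi> \<circ> h \<circ> \<Phi>\<close> with local diffeomorphisms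
  \<open>\<Phi> = (a, b)\<close> and \<open>\<Psi>\<close>. Then \<open>df = a P da + b Q db\<close> with independent \<open>P, Q\<close>, and
  \<open>\<lambda> = a b \<Delta> det D\<Phi>\<close> where \<open>\<Delta> = det (P, Q, \<nu>)\<close> does not vanish near the origin. A regular
  singular curve therefore runs inside \<open>b = 0\<close>, say, where \<open>d\<lambda>(\<eta>) = a \<Delta> det D\<Phi> db(\<eta>)\<close> changes
  sign with \<open>a\<close>, that is, at \<open>t = 0\<close>. Since the image curve has vanishing velocity at \<open>t = 0\<close>,
  the unsigned quotient in the singular curvature is asymptotic to a nonzero constant divided by
  \<open>\<bar>t\<bar>\<close>, so the singular curvature behaves like a nonzero constant divided by \<open>t\<close>.
  Away from the origin, the square \<open>a\<^sup>2\<close> is itself a coordinate, and subtracting \<open>a\<^sup>3\<close>, a smooth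
  function of it, from the third component leaves a cuspidal edge.\<close>

section \<open>Smooth maps\<close>

text \<open>Since \<open>S\<close> is open, equality on \<open>S\<close> is equality near each of
  its points, so both maps have the same derivatives there. This allows explicit formulas to replace
  \<open>frechet_derivative\<close> inside \<open>Ck_on\<close>.\<close>

lemma Ck_on_cong:
  assumes "open S" "\<And>x. x \<in> S \<Longrightarrow> f x = g x"
  shows "Ck_on k S f \<longleftrightarrow> Ck_on k S g"
  using assms(2)
proof (induction k arbitrary: f g)
  case 0
  then show ?case by (simp cong: continuous_on_cong)
next
  case (Suc k)
  have ev: "\<forall>\<^sub>F y in at x. f y = g y" if "x \<in> S" for x
    using eventually_at_topological assms(1) Suc.prems that by blast
  have der: "(f has_derivative D) (at x) \<longleftrightarrow> (g has_derivative D) (at x)" if "x \<in> S" for x D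
    using has_derivative_transform_within_open[OF _ assms(1) that] Suc.prems by metis
  then have fd: "frechet_derivative f (at x) = frechet_derivative g (at x)" if "x \<in> S" for x
    using that by (simp add: frechet_derivative_def)
  have "Ck_on k S (\<lambda>x. frechet_derivative f (at x) v) = Ck_on k S (\<lambda>x. frechet_derivative g (at x) v)" for v
    by (rule Suc.IH) (simp add: fd)
  moreover have "f differentiable (at x) \<longleftrightarrow> g differentiable (at x)" if "x \<in> S" for x
    using der that by (simp add: differentiable_def)
  ultimately show ?case by simp
qed

lemma Ck_on_subset: "Ck_on k S f \<Longrightarrow> T \<subseteq> S \<Longrightarrow> Ck_on k T f"
  by (induction k arbitrary: f) (auto intro: continuous_on_subset)

text \<open>The recursion peels off derivatives from the outside, so lowering the order only bites
  at the innermost level, where differentiability gives continuity.\<close>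

lemma Ck_on_SucD: "Ck_on (Suc k) S f \<Longrightarrow> Ck_on k S f"
proof (induction k arbitrary: f)
  case 0
  then show ?case
    by (auto intro!: continuous_at_imp_continuous_on differentiable_imp_continuous_within)
next
  case (Suc k)
  then show ?case by (metis Ck_on.simps(2))
qed

lemma Ck_on_SucI:
  assumes "open S" "\<And>x. x \<in> S \<Longrightarrow> (f has_derivative D x) (at x)" "\<And>v. Ck_on k S (\<lambda>x. D x v)"
  shows "Ck_on (Suc k) S f"
proof -
  have "frechet_derivative f (at x) = D x" if "x \<in> S" for x
    using assms(2)[OF that] frechet_derivative_at by metis
  then have "Ck_on k S (\<lambda>x. frechet_derivative f (at x) v)" for v
    using Ck_on_cong[OF assms(1), of "\<lambda>x. D x v" "\<lambda>x. frechet_derivative f (at x) v"] assms(3)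
    by metis
  then show ?thesis using assms(2) by (auto simp: differentiable_def)
qed

lemma Ck_on_SucE:
  assumes "Ck_on (Suc k) S f" "x \<in> S"
  shows "(f has_derivative frechet_derivative f (at x)) (at x)"
  using assms frechet_derivative_works by auto

lemma Ck_on_const: "open S \<Longrightarrow> Ck_on k S (\<lambda>x. c)"
  by (induction k arbitrary: c) (auto intro!: Ck_on_SucI[where D="\<lambda>x v. 0"] simp del: Ck_on.simps(2))

lemma Ck_on_bounded_linear:
  assumes "open S" "bounded_linear f" shows "Ck_on k S f"
proof (cases k)
  case 0
  then show ?thesis using assms(2) by (simp add: linear_continuous_on)
next
  case (Suc n)
  show ?thesis unfolding Suc
    by (rule Ck_on_SucI[OF assms(1) bounded_linear_imp_has_derivative[OF assms(2)]])
      (rule Ck_on_const[OF assms(1)])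
qed

lemma Ck_on_add:
  assumes "open S" shows "Ck_on k S f \<Longrightarrow> Ck_on k S g \<Longrightarrow> Ck_on k S (\<lambda>x. f x + g x)"
proof (induction k arbitrary: f g)
  case 0 then show ?case by (simp add: continuous_on_add)
next
  case (Suc k)
  show ?case
    by (rule Ck_on_SucI[OF assms has_derivative_add[OF Ck_on_SucE[OF Suc.prems(1)] Ck_on_SucE[OF Suc.prems(2)]]])
      (use Suc in auto)
qed

text \<open>The Leibniz rule: each summand of the derivative pairs an original map, lowered by one
  order, with a derivative. Products, scalings and inner products are all instances.\<close>

lemma Ck_on_bilinear:
  fixes B :: "'b::real_normed_vector \<Rightarrow> 'c::real_normed_vector \<Rightarrow> 'd::real_normed_vector"
  assumes "bounded_bilinear B" "open S"
  shows "Ck_on k S f \<Longrightarrow> Ck_on k S g \<Longrightarrow> Ck_on k S (\<lambda>x. B (f x) (g x))"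
proof (induction k arbitrary: f g)
  case 0
  then show ?case using bounded_bilinear.continuous_on[OF assms(1)] by simp
next
  case (Suc k)
  show ?case
  proof (rule Ck_on_SucI[OF assms(2)])
    show "((\<lambda>x. B (f x) (g x)) has_derivative
        (\<lambda>v. B (f x) (frechet_derivative g (at x) v) + B (frechet_derivative f (at x) v) (g x))) (at x)"
      if "x \<in> S" for x
      using bounded_bilinear.FDERIV[OF assms(1) Ck_on_SucE[OF Suc.prems(1) that] Ck_on_SucE[OF Suc.prems(2) that]] .
    show "Ck_on k S (\<lambda>x. B (f x) (frechet_derivative g (at x) v) + B (frechet_derivative f (at x) v) (g x))" for v
      using Suc.prems Suc.prems[THEN Ck_on_SucD] by (intro Ck_on_add Suc.IH assms(2)) simp_all
  qed
qed

lemma Ck_on_sum: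
  assumes "open S" "\<And>i. i \<in> I \<Longrightarrow> Ck_on k S (f i)"
  shows "Ck_on k S (\<lambda>x. \<Sum>i\<in>I. f i x)"
  using assms(2)
  by (induction I rule: infinite_finite_induct) (simp_all add: Ck_on_add Ck_on_const assms(1))

lemma Ck_on_compose:
  fixes g :: "'a::euclidean_space \<Rightarrow> 'b::euclidean_space" and f :: "'b \<Rightarrow> 'c::real_normed_vector"
  assumes "open U" "open V"
  shows "Ck_on k V f \<Longrightarrow> Ck_on k U g \<Longrightarrow> g ` U \<subseteq> V \<Longrightarrow> Ck_on k U (\<lambda>x. f (g x))"
proof (induction k arbitrary: f)
  case 0
  then show ?case by (auto intro: continuous_on_compose2)
next
  case (Suc k)
  show ?case
  proof (rule Ck_on_SucI[OF assms(1)])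
    fix x assume x: "x \<in> U"
    let ?F = "frechet_derivative f (at (g x))"
    let ?G = "frechet_derivative g (at x)"
    have F: "(f has_derivative ?F) (at (g x))"
      using Ck_on_SucE[OF Suc.prems(1)] Suc.prems(3) x by blast
    have D: "((\<lambda>x. f (g x)) has_derivative (\<lambda>v. ?F (?G v))) (at x)"
      using has_derivative_compose[OF Ck_on_SucE[OF Suc.prems(2) x] F] .
    \<comment> \<open>In the chain rule both the point and the direction of the outer derivative
      vary with \<open>x\<close>. Expanding in \<open>Basis\<close> leaves derivatives in fixed
      directions, which the induction hypothesis covers, with scalar coefficients.\<close>
    have F_sum: "?F w = (\<Sum>i\<in>Basis. (w \<bullet> i) *\<^sub>R ?F i)" for w
    proof -
      have lin: "linear ?F" using F has_derivative_linear by blast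
      have "?F w = ?F (\<Sum>i\<in>Basis. (w \<bullet> i) *\<^sub>R i)" by (simp only: euclidean_representation)
      then show ?thesis by (simp add: linear_sum[OF lin] linear_scale[OF lin])
    qed
    show "((\<lambda>x. f (g x)) has_derivative (\<lambda>v. \<Sum>i\<in>Basis. (?G v \<bullet> i) *\<^sub>R ?F i)) (at x)"
      by (rule has_derivative_eq_rhs[OF D ext[OF F_sum]])
  next
    fix v
    show "Ck_on k U (\<lambda>x. \<Sum>i\<in>Basis. (frechet_derivative g (at x) v \<bullet> i) *\<^sub>R frechet_derivative f (at (g x)) i)"
    proof (intro Ck_on_sum Ck_on_bilinear[OF bounded_bilinear_scaleR] Ck_on_bilinear[OF bounded_bilinear_inner]
        Ck_on_const assms)
      fix i :: 'b
      show "Ck_on k U (\<lambda>x. frechet_derivative g (at x) v)" using Suc.prems by simp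
      show "Ck_on k U (\<lambda>x. frechet_derivative f (at (g x)) i)"
        using Suc.prems Ck_on_SucD[OF Suc.prems(2)] by (intro Suc.IH) simp_all
    qed
  qed
qed

section \<open>Closure properties of smooth maps\<close>

lemma smooth_on_cong:
  "open S \<Longrightarrow> (\<And>x. x \<in> S \<Longrightarrow> f x = g x) \<Longrightarrow> smooth_on S f \<longleftrightarrow> smooth_on S g"
  unfolding smooth_on_def using Ck_on_cong by blast

lemma smooth_on_subset: "smooth_on S f \<Longrightarrow> T \<subseteq> S \<Longrightarrow> smooth_on T f"
  unfolding smooth_on_def using Ck_on_subset by blast

lemma smooth_on_const: "open S \<Longrightarrow> smooth_on S (\<lambda>x. c)"
  by (simp add: smooth_on_def Ck_on_const)

lemma smooth_on_bounded_linear: "open S \<Longrightarrow> bounded_linear f \<Longrightarrow> smooth_on S f"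
  by (simp add: smooth_on_def Ck_on_bounded_linear)

lemma smooth_on_add: "open S \<Longrightarrow> smooth_on S f \<Longrightarrow> smooth_on S g \<Longrightarrow> smooth_on S (\<lambda>x. f x + g x)"
  by (simp add: smooth_on_def Ck_on_add)

lemma smooth_on_bilinear:
  assumes "bounded_bilinear B" "open S" "smooth_on S f" "smooth_on S g"
  shows "smooth_on S (\<lambda>x. B (f x) (g x))"
  using assms Ck_on_bilinear unfolding smooth_on_def by metis

lemmas smooth_on_mult = smooth_on_bilinear[OF bounded_bilinear_mult]
lemmas smooth_on_scaleR = smooth_on_bilinear[OF bounded_bilinear_scaleR]

lemma smooth_on_sum:
  "open S \<Longrightarrow> (\<And>i. i \<in> I \<Longrightarrow> smooth_on S (f i)) \<Longrightarrow> smooth_on S (\<lambda>x. \<Sum>i\<in>I. f i x)"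
  by (simp add: smooth_on_def Ck_on_sum)

lemma smooth_on_compose:
  fixes g :: "'a::euclidean_space \<Rightarrow> 'b::euclidean_space" and f :: "'b \<Rightarrow> 'c::real_normed_vector"
  assumes "open U" "open V" "smooth_on V f" "smooth_on U g" "g ` U \<subseteq> V"
  shows "smooth_on U (\<lambda>x. f (g x))"
  using assms Ck_on_compose unfolding smooth_on_def by metis

lemma smooth_on_linear_compose:
  fixes g :: "'a::euclidean_space \<Rightarrow> 'b::euclidean_space"
  assumes "bounded_linear f" "open U" "smooth_on U g"
  shows "smooth_on U (\<lambda>x. f (g x))"
  using smooth_on_compose[OF assms(2) open_UNIV _ assms(3)] smooth_on_bounded_linear[OF open_UNIV assms(1)]
  by blast

lemma smooth_on_minus:
  fixes f :: "'a::euclidean_space \<Rightarrow> 'b::euclidean_space"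
  shows "open S \<Longrightarrow> smooth_on S f \<Longrightarrow> smooth_on S (\<lambda>x. - f x)"
  using smooth_on_linear_compose[OF bounded_linear_minus[OF bounded_linear_ident]] by blast

lemma smooth_on_diff:
  fixes f g :: "'a::euclidean_space \<Rightarrow> 'b::euclidean_space"
  shows "open S \<Longrightarrow> smooth_on S f \<Longrightarrow> smooth_on S g \<Longrightarrow> smooth_on S (\<lambda>x. f x - g x)"
  using smooth_on_add[of S f "\<lambda>x. - g x"] smooth_on_minus[of S g] by simp

lemma smooth_on_power:
  fixes f :: "'a::euclidean_space \<Rightarrow> real"
  shows "open S \<Longrightarrow> smooth_on S f \<Longrightarrow> smooth_on S (\<lambda>x. f x ^ n)"
  by (induction n) (simp_all add: smooth_on_const smooth_on_mult)

lemma smooth_on_id: "open S \<Longrightarrow> smooth_on S (\<lambda>x. x)"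
  by (rule smooth_on_bounded_linear[OF _ bounded_linear_ident])

lemma smooth_on_nth: "open S \<Longrightarrow> smooth_on S f \<Longrightarrow> smooth_on S (\<lambda>x. (f x :: real^'n) $ i)"
  by (rule smooth_on_linear_compose[OF bounded_linear_vec_nth])

lemma smooth_on_vec:
  fixes f :: "'a::euclidean_space \<Rightarrow> real^'n"
  assumes "open S" "\<And>i. smooth_on S (\<lambda>x. f x $ i)"
  shows "smooth_on S f"
proof -
  have "smooth_on S (\<lambda>x. \<Sum>i\<in>UNIV. f x $ i *\<^sub>R (axis i 1 :: real^'n))"
    by (intro smooth_on_sum smooth_on_scaleR smooth_on_const assms)
  moreover have "f = (\<lambda>x. \<Sum>i\<in>UNIV. f x $ i *\<^sub>R axis i 1)"
    by (simp add: basis_expansion flip: scalar_mult_eq_scaleR)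
  ultimately show ?thesis by metis
qed

lemma smooth_on_vector2:
  fixes f g :: "'a::euclidean_space \<Rightarrow> real"
  assumes "open S" "smooth_on S f" "smooth_on S g"
  shows "smooth_on S (\<lambda>x. vector [f x, g x] :: real^2)"
proof (rule smooth_on_vec[OF assms(1)])
  fix i :: 2 show "smooth_on S (\<lambda>x. (vector [f x, g x] :: real^2) $ i)"
    using exhaust_2[of i] assms by auto
qed

lemma smooth_on_vector3:
  fixes f g h :: "'a::euclidean_space \<Rightarrow> real"
  assumes "open S" "smooth_on S f" "smooth_on S g" "smooth_on S h"
  shows "smooth_on S (\<lambda>x. vector [f x, g x, h x] :: real^3)"
proof (rule smooth_on_vec[OF assms(1)])
  fix i :: 3 show "smooth_on S (\<lambda>x. (vector [f x, g x, h x] :: real^3) $ i)"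
    using exhaust_3[of i] assms by auto
qed

text \<open>Supplies the square root and the power 3/2 in the coordinate changes to a cuspidal edge.
  The exponent is generalized in the induction because differentiation lowers it by one.\<close>

lemma smooth_on_powr:
  fixes f :: "'a::euclidean_space \<Rightarrow> real"
  assumes "open S" "smooth_on S f" "\<And>x. x \<in> S \<Longrightarrow> f x > 0"
  shows "smooth_on S (\<lambda>x. f x powr a)"
proof -
  have "Ck_on k {0<..} (\<lambda>x::real. x powr a)" for k
  proof (induction k arbitrary: a)
    case 0
    then show ?case by (auto intro!: continuous_intros)
  next
    case (Suc k)
    show ?case
    proof (rule Ck_on_SucI[OF open_greaterThan])
      show "((\<lambda>x. x powr a) has_derivative (\<lambda>v. v * (a * x powr (a - 1)))) (at x)" if "x \<in> {0<..}" for x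
        using has_real_derivative_powr[of x a] that
        unfolding has_field_derivative_def by (simp only: mult.commute[of _ "a * _"] greaterThan_iff)
      show "Ck_on k {0<..} (\<lambda>x. v * (a * x powr (a - 1)))" for v
        by (intro Ck_on_bilinear[OF bounded_bilinear_mult] Ck_on_const Suc open_greaterThan)
    qed
  qed
  then show ?thesis
    by (intro smooth_on_compose[OF assms(1) open_greaterThan[of 0] _ assms(2)])
      (use assms(3) in \<open>auto simp: smooth_on_def\<close>)
qed

lemma smooth_on_has_derivative:
  assumes "smooth_on S f" "x \<in> S"
  shows "(f has_derivative frechet_derivative f (at x)) (at x)"
  using assms Ck_on_SucE unfolding smooth_on_def by blast

lemma smooth_on_frechet_derivative:
  "smooth_on S f \<Longrightarrow> smooth_on S (\<lambda>x. frechet_derivative f (at x) v)"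
  unfolding smooth_on_def by (metis Ck_on.simps(2))

lemma smooth_on_continuous_on: "smooth_on S f \<Longrightarrow> continuous_on S f"
  unfolding smooth_on_def by (metis Ck_on.simps(1))

text \<open>On the real line a derivative is multiplication by its value at 1, so the vector
  derivative is the directional derivative along 1.\<close>

lemma smooth_on_vderiv:
  assumes "smooth_on J g" "open J"
  shows "smooth_on J (vderiv g)" "t \<in> J \<Longrightarrow> (g has_vector_derivative vderiv g t) (at t)"
proof -
  have eq: "vderiv g t = frechet_derivative g (at t) 1"
    and "(g has_vector_derivative vderiv g t) (at t)" if "t \<in> J" for t
  proof -
    have d: "(g has_derivative frechet_derivative g (at t)) (at t)"
      by (rule smooth_on_has_derivative[OF assms(1) that])
    interpret linear "frechet_derivative g (at t)" using d by (rule has_derivative_linear)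
    have "frechet_derivative g (at t) = (\<lambda>x. x *\<^sub>R frechet_derivative g (at t) 1)"
      by (rule ext) (metis scale mult.right_neutral real_scaleR_def)
    then have v: "(g has_vector_derivative frechet_derivative g (at t) 1) (at t)"
      using d unfolding has_vector_derivative_def by metis
    then show "vderiv g t = frechet_derivative g (at t) 1"
      unfolding vderiv_def by (rule vector_derivative_at)
    then show "(g has_vector_derivative vderiv g t) (at t)" using v by simp
  qed
  then show "t \<in> J \<Longrightarrow> (g has_vector_derivative vderiv g t) (at t)" by blast
  show "smooth_on J (vderiv g)"
    using smooth_on_frechet_derivative[OF assms(1), of 1]
      smooth_on_cong[of J "vderiv g" "\<lambda>t. frechet_derivative g (at t) 1", OF assms(2) eq] by blast
qed

section \<open>Local diffeomorphisms\<close>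

text \<open>Unlike \<open>diffeo_germ\<close>, neither the base point nor its image is tied to the
  origin; cuspidal edges have to be examined at points other than 0.\<close>

definition diffeo_at :: "('a::euclidean_space \<Rightarrow> 'a) \<Rightarrow> 'a \<Rightarrow> bool" where
  "diffeo_at S p \<longleftrightarrow>
     (\<exists>U V S'. open U \<and> open V \<and> p \<in> U \<and> homeomorphism U V S S' \<and> smooth_on U S \<and> smooth_on V S')"

lemma diffeo_germ_iff: "diffeo_germ S \<longleftrightarrow> S 0 = 0 \<and> diffeo_at S 0"
  unfolding diffeo_germ_def diffeo_at_def by blast

lemma diffeo_atI:
  assumes "open U" "open V" "p \<in> U" "smooth_on U S" "smooth_on V S'"
    "S ` U \<subseteq> V" "S' ` V \<subseteq> U" "\<And>x. x \<in> U \<Longrightarrow> S' (S x) = x" "\<And>y. y \<in> V \<Longrightarrow> S (S' y) = y"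
  shows "diffeo_at S p"
proof -
  have "homeomorphism U V S S'"
    using assms by (intro homeomorphismI smooth_on_continuous_on)
  then show ?thesis using assms unfolding diffeo_at_def by blast
qed

lemma diffeo_atE:
  assumes "diffeo_at S p"
  obtains U V S' where "open U" "open V" "p \<in> U" "smooth_on U S" "smooth_on V S'"
    "S ` U \<subseteq> V" "S' ` V \<subseteq> U" "\<And>x. x \<in> U \<Longrightarrow> S' (S x) = x" "\<And>y. y \<in> V \<Longrightarrow> S (S' y) = y"
proof -
  obtain U V S' where "open U" "open V" "p \<in> U" "homeomorphism U V S S'" "smooth_on U S" "smooth_on V S'"
    using assms unfolding diffeo_at_def by blast
  then show ?thesis using that[of U V S'] by (simp add: homeomorphism_def)
qed

lemma eventually_diffeo_at: "diffeo_at S p \<Longrightarrow> \<forall>\<^sub>F x in nhds p. diffeo_at S x"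
  unfolding diffeo_at_def eventually_nhds by blast

lemma diffeo_at_compose:
  assumes "diffeo_at S p" "diffeo_at T (S p)"
  shows "diffeo_at (\<lambda>x. T (S x)) p"
proof -
  obtain U V S' where S: "open U" "open V" "p \<in> U" "smooth_on U S" "smooth_on V S'"
    "S ` U \<subseteq> V" "S' ` V \<subseteq> U" "\<And>x. x \<in> U \<Longrightarrow> S' (S x) = x" "\<And>y. y \<in> V \<Longrightarrow> S (S' y) = y"
    by (rule diffeo_atE[OF assms(1)]) blast
  obtain U2 V2 T' where T: "open U2" "open V2" "S p \<in> U2" "smooth_on U2 T" "smooth_on V2 T'"
    "T ` U2 \<subseteq> V2" "T' ` V2 \<subseteq> U2" "\<And>x. x \<in> U2 \<Longrightarrow> T' (T x) = x" "\<And>y. y \<in> V2 \<Longrightarrow> T (T' y) = y"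
    by (rule diffeo_atE[OF assms(2)]) blast
  have o1: "open (U \<inter> S -` U2)"
    using S T by (intro continuous_open_preimage smooth_on_continuous_on)
  have o2: "open (V2 \<inter> T' -` V)"
    using S T by (intro continuous_open_preimage smooth_on_continuous_on)
  show ?thesis
  proof (rule diffeo_atI[OF o1 o2, where S'="\<lambda>y. S' (T' y)"])
    show "smooth_on (U \<inter> S -` U2) (\<lambda>x. T (S x))"
      by (rule smooth_on_compose[OF o1 T(1) T(4) smooth_on_subset[OF S(4)]]) auto
    show "smooth_on (V2 \<inter> T' -` V) (\<lambda>y. S' (T' y))"
      by (rule smooth_on_compose[OF o2 S(2) S(5) smooth_on_subset[OF T(5)]]) auto
    show "(\<lambda>x. T (S x)) ` (U \<inter> S -` U2) \<subseteq> V2 \<inter> T' -` V"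
      using S(6) T(6,8) by (auto simp: image_subset_iff)
    show "(\<lambda>y. S' (T' y)) ` (V2 \<inter> T' -` V) \<subseteq> U \<inter> S -` U2"
      using S(7,9) T(7) by (auto simp: image_subset_iff)
    show "p \<in> U \<inter> S -` U2" using S(3) T(3) by simp
    show "S' (T' (T (S x))) = x" if "x \<in> U \<inter> S -` U2" for x using that S(8) T(8) by simp
    show "T (S (S' (T' y))) = y" if "y \<in> V2 \<inter> T' -` V" for y using that S(9) T(9) by simp
  qed
qed

lemma diffeo_at_linear:
  assumes "bounded_linear L" "bounded_linear L'" "\<And>x. L' (L x) = x" "\<And>x. L (L' x) = x"
  shows "diffeo_at L p"
  by (rule diffeo_atI[of UNIV UNIV _ _ L']) (use assms in \<open>auto intro: smooth_on_bounded_linear\<close>)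

lemma diffeo_germ_linear:
  assumes "bounded_linear L" "bounded_linear L'" "\<And>x. L' (L x) = x" "\<And>x. L (L' x) = x"
  shows "diffeo_germ L"
  using diffeo_at_linear[OF assms] linear_0[OF bounded_linear.linear[OF assms(1)]]
  by (simp add: diffeo_germ_iff)

lemma diffeo_at_translation: "diffeo_at (\<lambda>x. x + c) p"
  by (rule diffeo_atI[of UNIV UNIV _ _ "\<lambda>x. x - c"])
    (auto intro!: smooth_on_add smooth_on_diff smooth_on_id smooth_on_const)

lemma diffeo_germ_compose:
  "diffeo_germ S \<Longrightarrow> diffeo_germ T \<Longrightarrow> diffeo_germ (\<lambda>x. T (S x))"
  by (simp add: diffeo_germ_iff diffeo_at_compose)

lemma diffeo_germ_centered:
  assumes "diffeo_at S p" "S p = 0"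
  shows "diffeo_germ (\<lambda>x. S (p + x))"
proof -
  have "diffeo_at (\<lambda>x. S (x + p)) 0"
    by (rule diffeo_at_compose[OF diffeo_at_translation]) (use assms in simp)
  then show ?thesis using assms by (simp add: diffeo_germ_iff add.commute)
qed

lemma diffeo_at_tendsto:
  assumes "diffeo_at S p" shows "filterlim S (nhds (S p)) (nhds p)"
proof -
  have "isCont S p"
    using assms unfolding diffeo_at_def
    by (metis continuous_on_eq_continuous_at smooth_on_continuous_on)
  then show ?thesis by (simp add: isCont_def tendsto_at_iff_tendsto_nhds)
qed

section \<open>The separated normal form\<close>

text \<open>The linear change \<open>x = \<surd>3 (a + b)\<close>, \<open>y = a - b\<close> separates the variables of the
  normal form: \<open>x y = \<surd>3 (a\<^sup>2 - b\<^sup>2)\<close>, \<open>x\<^sup>2 + 3 y\<^sup>2 = 6 (a\<^sup>2 + b\<^sup>2)\<close>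
  and \<open>x\<^sup>2 y + y\<^sup>3 = 4 (a\<^sup>3 - b\<^sup>3)\<close>.\<close>

definition D4_plus_separated_form :: "real^2 \<Rightarrow> real^3" where
  "D4_plus_separated_form x = vector [(x$1)\<^sup>2, (x$2)\<^sup>2, (x$1)^3 - (x$2)^3]"

lemma linear_vector2:
  fixes f g :: "'a::euclidean_space \<Rightarrow> real"
  assumes "linear f" "linear g" shows "bounded_linear (\<lambda>x. vector [f x, g x] :: real^2)"
  using assms
  unfolding linear_conv_bounded_linear[symmetric]
  by (intro linearI) (auto simp: vec_eq_iff forall_2 linear_add linear_scale)

lemma linear_vector3:
  fixes f g h :: "'a::euclidean_space \<Rightarrow> real"
  assumes "linear f" "linear g" "linear h" shows "bounded_linear (\<lambda>x. vector [f x, g x, h x] :: real^3)"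
  using assms
  unfolding linear_conv_bounded_linear[symmetric]
  by (intro linearI) (auto simp: vec_eq_iff forall_3 linear_add linear_scale)

lemma D4_plus_separated:
  assumes "D4_plus f"
  obtains S T where "diffeo_germ S" "diffeo_germ T"
    "\<forall>\<^sub>F x in nhds 0. D4_plus_separated_form (S x) = T (f x)"
proof -
  obtain S T where ST: "diffeo_germ S" "diffeo_germ T"
    "\<forall>\<^sub>F x in nhds 0. D4_plus_normal_form (S x) = T (f x)"
    using assms unfolding D4_plus_def right_left_equivalent_def by blast
  \<comment> \<open>\<open>L\<close> recovers \<open>a\<close> and \<open>b\<close> from
    \<open>x\<close> and \<open>y\<close>; its inverse \<open>L'\<close> is the substitution
    described above.\<close>
  define L :: "real^2 \<Rightarrow> real^2" where
    "L = (\<lambda>x. vector [sqrt 3 * x$1 / 6 + x$2 / 2, sqrt 3 * x$1 / 6 - x$2 / 2])"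
  define L' :: "real^2 \<Rightarrow> real^2" where
    "L' = (\<lambda>x. vector [sqrt 3 * (x$1 + x$2), x$1 - x$2])"
  \<comment> \<open>\<open>M\<close> solves the three displayed identities for the squares of
    \<open>a\<close> and \<open>b\<close> and for the difference of their cubes.\<close>
  define M :: "real^3 \<Rightarrow> real^3" where
    "M = (\<lambda>x. vector [x$2 / 12 + sqrt 3 * x$1 / 6, x$2 / 12 - sqrt 3 * x$1 / 6, x$3 / 4])"
  define M' :: "real^3 \<Rightarrow> real^3" where
    "M' = (\<lambda>x. vector [sqrt 3 * (x$1 - x$2), 6 * (x$1 + x$2), 4 * x$3])"
  have s: "sqrt 3 * sqrt 3 = (3::real)" "sqrt 3 * (sqrt 3 * z) = 3 * z" for z :: real by simp_all
  have "diffeo_germ L"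
    by (rule diffeo_germ_linear[where L'=L'])
      (auto simp: L_def L'_def vec_eq_iff forall_2 field_simps s intro!: linear_vector2 linearI)
  moreover have "diffeo_germ M"
    by (rule diffeo_germ_linear[where L'=M'])
      (auto simp: M_def M'_def vec_eq_iff forall_3 field_simps s intro!: linear_vector3 linearI)
  moreover have "D4_plus_separated_form (L x) = M (D4_plus_normal_form x)" for x
  proof -
    show ?thesis
      unfolding D4_plus_separated_form_def D4_plus_normal_form_def L_def M_def
      by (simp add: vec_eq_iff forall_3 field_simps power2_eq_square power3_eq_cube s)
  qed
  moreover have "\<forall>\<^sub>F x in nhds 0. M (D4_plus_normal_form (S x)) = M (T (f x))"
    using ST(3) by eventually_elim simp
  ultimately show ?thesis
    using that[OF diffeo_germ_compose[OF ST(1)] diffeo_germ_compose[OF ST(2)], of L M] by simp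
qed

text \<open>On the half plane where the first coordinate keeps the sign \<open>s\<close> it has at
  \<open>y\<close>, that coordinate is \<open>s\<close> times the root of its square, and its cube
  is \<open>s\<close> times the power 3/2 of its square. The cube is thus a smooth function of the
  first target coordinate, and \<open>\<tau>\<close> removes it, leaving the cube of the second
  coordinate. Subtracting \<open>a\<^sup>2\<close> moves the base points to 0.\<close>

lemma D4_plus_separated_cuspidal:
  assumes "y $ 2 = 0" "y $ 1 \<noteq> 0"
  obtains \<sigma> \<tau> where "diffeo_at \<sigma> y" "\<sigma> y = 0"
    "diffeo_at \<tau> (D4_plus_separated_form y)" "\<tau> (D4_plus_separated_form y) = 0"
    "\<forall>\<^sub>F x in nhds y. cuspidal_edge_normal_form (\<sigma> x) = \<tau> (D4_plus_separated_form x)"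
proof -
  define a where "a = y $ 1"
  define s where "s = sgn a"
  have a: "a \<noteq> 0" using assms by (simp add: a_def)
  have s: "s * s = 1" "a * s > 0" using a by (auto simp: s_def sgn_if)
  define \<sigma> :: "real^2 \<Rightarrow> real^2" where "\<sigma> = (\<lambda>x. vector [(x$1)\<^sup>2 - a\<^sup>2, x$2])"
  define \<sigma>' :: "real^2 \<Rightarrow> real^2" where "\<sigma>' = (\<lambda>x. vector [s * (x$1 + a\<^sup>2) powr (1/2), x$2])"
  define \<tau> :: "real^3 \<Rightarrow> real^3" where
    "\<tau> = (\<lambda>x. vector [x$1 - a\<^sup>2, x$2, s * (x$1) powr (3/2) - x$3])"
  define \<tau>' :: "real^3 \<Rightarrow> real^3" where
    "\<tau>' = (\<lambda>x. vector [x$1 + a\<^sup>2, x$2, s * (x$1 + a\<^sup>2) powr (3/2) - x$3])"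
  define U where "U = {x::real^2. s * x$1 > 0}"
  define V where "V = {x::real^2. x$1 + a\<^sup>2 > 0}"
  have o: "open U" "open V" unfolding U_def V_def by (auto intro!: open_Collect_less continuous_intros)
  have yU: "y \<in> U" using s by (simp add: U_def a_def mult.commute)
  have root: "s * (x\<^sup>2) powr (1/2) = x" and cube: "s * (x\<^sup>2) powr (3/2) = x^3" if "s * x > 0" for x
  proof -
    have sx: "s = sgn x" using that a by (auto simp: s_def sgn_if zero_less_mult_iff split: if_splits)
    have x: "x \<noteq> 0" using that by auto
    have r: "(x\<^sup>2) powr (1/2) = \<bar>x\<bar>" by (simp add: powr_half_sqrt)
    show "s * (x\<^sup>2) powr (1/2) = x" using r sx by (simp add: sgn_mult_abs)
    have "(x\<^sup>2) powr (3/2) = ((x\<^sup>2) powr (1/2)) powr 3" by (simp only: powr_powr) simp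
    then have "(x\<^sup>2) powr (3/2) = ((x\<^sup>2) powr (1/2)) ^ 3" by simp
    then show "s * (x\<^sup>2) powr (3/2) = x^3" using r sx by (auto simp: sgn_if abs_if power3_eq_cube)
  qed
  have "diffeo_at \<sigma> y"
  proof (rule diffeo_atI[OF o yU, where S'=\<sigma>'])
    show "smooth_on U \<sigma>" unfolding \<sigma>_def
      by (intro smooth_on_vector2 smooth_on_diff smooth_on_power smooth_on_nth smooth_on_const smooth_on_id o)
    show "smooth_on V \<sigma>'" unfolding \<sigma>'_def
      by (intro smooth_on_vector2 smooth_on_powr smooth_on_mult smooth_on_add smooth_on_nth smooth_on_const smooth_on_id o)
        (simp add: V_def)
    show "\<sigma> ` U \<subseteq> V" by (auto simp: U_def V_def \<sigma>_def)
    show "\<sigma>' ` V \<subseteq> U" using s by (auto simp: U_def V_def \<sigma>'_def mult.assoc[symmetric])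
    show "\<sigma>' (\<sigma> x) = x" if "x \<in> U" for x
      using that root by (simp add: U_def \<sigma>_def \<sigma>'_def vec_eq_iff forall_2)
    show "\<sigma> (\<sigma>' x) = x" if "x \<in> V" for x
      using that s by (simp add: V_def \<sigma>_def \<sigma>'_def vec_eq_iff forall_2 powr_half_sqrt power_mult_distrib power2_eq_square[of s])
  qed
  moreover have "\<sigma> y = 0" using assms by (simp add: \<sigma>_def a_def vec_eq_iff forall_2)
  moreover have "diffeo_at \<tau> (D4_plus_separated_form y)"
  proof -
    \<comment> \<open>The names now denote half spaces of the target: \<open>\<tau>\<close> needs a
      positive first coordinate, \<open>\<tau>'\<close> one that is positive after the
      shift.\<close>
    define U where "U = {x::real^3. x$1 > 0}"
    define V where "V = {x::real^3. x$1 + a\<^sup>2 > 0}"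
    have o: "open U" "open V" unfolding U_def V_def by (auto intro!: open_Collect_less continuous_intros)
    show ?thesis
    proof (rule diffeo_atI[OF o, where S'=\<tau>'])
      show "D4_plus_separated_form y \<in> U"
        using assms by (simp add: U_def D4_plus_separated_form_def)
      show "smooth_on U \<tau>" unfolding \<tau>_def
        by (intro smooth_on_vector3 smooth_on_powr smooth_on_mult smooth_on_diff smooth_on_nth smooth_on_const smooth_on_id o)
          (simp add: U_def)
      show "smooth_on V \<tau>'" unfolding \<tau>'_def
        by (intro smooth_on_vector3 smooth_on_powr smooth_on_mult smooth_on_add smooth_on_diff smooth_on_nth smooth_on_const smooth_on_id o)
          (simp add: V_def)
    qed (auto simp: U_def V_def \<tau>_def \<tau>'_def vec_eq_iff forall_3)
  qed
  moreover have eq: "cuspidal_edge_normal_form (\<sigma> x) = \<tau> (D4_plus_separated_form x)" if "x \<in> U" for x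
    using that cube[of "x$1"]
    by (simp add: U_def \<sigma>_def \<tau>_def D4_plus_separated_form_def cuspidal_edge_normal_form_def vec_eq_iff forall_3)
  moreover have "\<tau> (D4_plus_separated_form y) = 0"
    using eq[OF yU] \<open>\<sigma> y = 0\<close> by (simp add: cuspidal_edge_normal_form_def vec_eq_iff forall_3)
  ultimately show ?thesis
    using that[of \<sigma> \<tau>] yU o unfolding eventually_nhds by blast
qed

text \<open>The required diffeomorphisms are \<open>\<sigma>\<close> after \<open>S\<close> and
  \<open>\<tau>\<close> after \<open>T\<close>, translated so that \<open>p\<close> and
  \<open>f p\<close> become origins.\<close>

lemma cuspidal_edge_at_of_separated:
  assumes f: "open W" "p \<in> W" "smooth_on W f"
    and S: "diffeo_at S p" and T: "diffeo_at T (f p)"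
    and eq: "\<forall>\<^sub>F x in nhds p. D4_plus_separated_form (S x) = T (f x)"
    and sing: "S p $ 2 = 0" "S p $ 1 \<noteq> 0"
  shows "cuspidal_edge_at f p"
proof -
  obtain \<sigma> \<tau> where \<sigma>: "diffeo_at \<sigma> (S p)" "\<sigma> (S p) = 0"
    and \<tau>: "diffeo_at \<tau> (D4_plus_separated_form (S p))" "\<tau> (D4_plus_separated_form (S p)) = 0"
    and st: "\<forall>\<^sub>F x in nhds (S p). cuspidal_edge_normal_form (\<sigma> x) = \<tau> (D4_plus_separated_form x)"
    using D4_plus_separated_cuspidal[OF sing] by blast
  have eqp: "D4_plus_separated_form (S p) = T (f p)" using eventually_nhds_x_imp_x[OF eq] .
  have "diffeo_germ (\<lambda>x. \<sigma> (S (p + x)))"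
    by (rule diffeo_germ_centered[of "\<lambda>x. \<sigma> (S x)"]) (use diffeo_at_compose[OF S \<sigma>(1)] \<sigma>(2) in auto)
  moreover have "diffeo_germ (\<lambda>y. \<tau> (T (f p + y)))"
    by (rule diffeo_germ_centered[of "\<lambda>x. \<tau> (T x)"]) (use diffeo_at_compose[OF T] \<tau> eqp in auto)
  moreover have "\<forall>\<^sub>F x in nhds 0. cuspidal_edge_normal_form (\<sigma> (S (p + x))) = \<tau> (T (f p + (f (p + x) - f p)))"
  proof -
    have "\<forall>\<^sub>F x in nhds p. cuspidal_edge_normal_form (\<sigma> (S x)) = \<tau> (D4_plus_separated_form (S x))"
      using diffeo_at_tendsto[OF S] st unfolding filterlim_iff by blast
    with eq have "\<forall>\<^sub>F x in nhds p. cuspidal_edge_normal_form (\<sigma> (S x)) = \<tau> (T (f x))"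
      by eventually_elim simp
    from eventually_compose_filterlim[OF this] have ?thesis if "filterlim (\<lambda>x. p + x) (nhds p) (nhds 0)"
      using that by simp
    moreover have "filterlim (\<lambda>x. p + x) (nhds p) (nhds 0)"
      using tendsto_add[OF tendsto_const[of p "nhds 0"] filterlim_ident[of "nhds (0::real^2)"]] by simp
    ultimately show ?thesis by blast
  qed
  ultimately have "right_left_equivalent (\<lambda>x. f (p + x) - f p) cuspidal_edge_normal_form"
    unfolding right_left_equivalent_def by blast
  moreover have "map_germ (\<lambda>x. f (p + x) - f p)"
  proof -
    have o: "open ((\<lambda>x. p + x) -` W)" by (rule open_vimage[OF f(1)]) (auto intro!: continuous_intros)
    have "smooth_on ((\<lambda>x. p + x) -` W) (\<lambda>x. f (p + x) - f p)"
      by (intro smooth_on_diff smooth_on_const o smooth_on_compose[OF o f(1) f(3)] smooth_on_add smooth_on_id) auto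
    then show ?thesis using f o unfolding map_germ_def by (intro conjI exI[of _ "(\<lambda>x. p + x) -` W"]) auto
  qed
  ultimately show ?thesis by (simp add: cuspidal_edge_at_def)
qed

section \<open>Determinants and limits\<close>

lemma det2_expand: "det2 a b = a$1 * b$2 - a$2 * b$1"
  by (simp add: det2_def det_2)

lemma det3_expand:
  "det3 a b c = a$1 * b$2 * c$3 + a$2 * b$3 * c$1 + a$3 * b$1 * c$2
     - a$1 * b$3 * c$2 - a$2 * b$1 * c$3 - a$3 * b$2 * c$1"
  by (simp add: det3_def det_3)

lemma tendsto_det3 [tendsto_intros]:
  assumes "(f \<longlongrightarrow> a) F" "(g \<longlongrightarrow> b) F" "(h \<longlongrightarrow> c) F"
  shows "((\<lambda>x. det3 (f x) (g x) (h x)) \<longlongrightarrow> det3 a b c) F"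
  unfolding det3_expand by (intro tendsto_intros assms)

text \<open>If the determinant vanished, \<open>n\<close> would be orthogonal to the cross product
  of \<open>p\<close> and \<open>q\<close>. Being orthogonal to both vectors, \<open>n\<close> is
  also parallel to that product, which must then be 0, making \<open>p\<close> and \<open>q\<close>
  dependent.\<close>

lemma det3_orthogonal_nonzero:
  assumes indep: "\<And>s t. s *\<^sub>R p + t *\<^sub>R q = 0 \<Longrightarrow> s = 0 \<and> t = 0"
    and n: "n \<noteq> 0" "p \<bullet> n = 0" "q \<bullet> n = 0"
  shows "det3 p q n \<noteq> 0"
proof
  assume 0: "det3 p q n = 0"
  let ?c = "cross3 p q"
  have "n \<bullet> ?c = 0"
    using 0 by (simp add: det3_expand cross3_def inner_vec_def sum_3 algebra_simps)
  moreover have "cross3 n ?c = 0"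
    using n by (simp add: Lagrange inner_commute)
  ultimately have "norm n * norm ?c = 0"
    using norm_and_cross_eq_0[of n ?c] by simp
  then have "?c = 0" using n by simp
  then have "collinear {0, p, q}" by (simp add: cross_eq_0)
  then consider "p = 0" | "q = 0" | c where "q = c *\<^sub>R p" by (auto simp: collinear_lemma)
  then show False
  proof cases
    case 1 then show False using indep[of 1 0] by simp
  next
    case 2 then show False using indep[of 0 1] by simp
  next
    case 3 then show False using indep[of "-c" 1] by simp
  qed
qed

text \<open>A product rule with a merely continuous factor: where \<open>g\<close> vanishes it is of
  order \<open>norm (x - p)\<close>, so replacing \<open>c x\<close> by \<open>c p\<close> costs
  only a smaller-order error. It is applied to coefficients built from the normal field, for which
  only continuity is carried along.\<close>

lemma has_derivative_mult_zero:
  fixes c g :: "'a::real_normed_vector \<Rightarrow> real"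
  assumes c: "isCont c p" and g: "(g has_derivative g') (at p)" and 0: "g p = 0"
  shows "((\<lambda>x. c x * g x) has_derivative (\<lambda>X. c p * g' X)) (at p)"
proof -
  have bl: "bounded_linear g'" using g by (rule has_derivative_bounded_linear)
  then obtain K where K: "\<And>x. norm (g' x) \<le> norm x * K" using bounded_linear.bounded by blast
  define q where "q = (\<lambda>x. norm (g x - g p - g' (x - p)) / norm (x - p))"
  have q: "(q \<longlongrightarrow> 0) (at p)"
    using g unfolding has_derivative_iff_norm q_def by blast
  have "((\<lambda>x. (c x - c p) * g x) has_derivative (\<lambda>X. 0)) (at p)"
    unfolding has_derivative_iff_norm
  proof
    have "((\<lambda>x. \<bar>c x - c p\<bar> * (q x + \<bar>K\<bar>)) \<longlongrightarrow> 0) (at p)"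
      using c q unfolding isCont_def by (auto intro!: tendsto_eq_intros)
    then show "((\<lambda>x. norm ((c x - c p) * g x - (c p - c p) * g p - 0) / norm (x - p)) \<longlongrightarrow> 0) (at p)"
    proof (rule Lim_null_comparison[rotated])
      \<comment> \<open>The difference quotient of \<open>g\<close> is at most its linearization
        error \<open>q x\<close> plus a bound for \<open>g'\<close>, and the factor
        \<open>c x - c p\<close> tends to 0.\<close>
      have "norm ((c x - c p) * g x) / norm (x - p) \<le> \<bar>c x - c p\<bar> * (q x + \<bar>K\<bar>)" if "x \<noteq> p" for x
      proof -
        have "\<bar>g x\<bar> \<le> norm (g x - g p - g' (x - p)) + norm (g' (x - p))" using 0 by simp
        also have "\<dots> \<le> norm (g x - g p - g' (x - p)) + norm (x - p) * \<bar>K\<bar>"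
          using K[of "x - p"] by (smt (verit) mult_left_mono norm_ge_zero)
        finally have "\<bar>g x\<bar> / norm (x - p) \<le> (norm (g x - g p - g' (x - p)) + norm (x - p) * \<bar>K\<bar>) / norm (x - p)"
          by (rule divide_right_mono) simp
        also have "\<dots> = q x + \<bar>K\<bar>" using that by (simp add: q_def add_divide_distrib)
        finally show ?thesis
          by (simp add: abs_mult mult_left_mono flip: times_divide_eq_right)
      qed
      then show "\<forall>\<^sub>F x in at p. norm (norm ((c x - c p) * g x - (c p - c p) * g p - 0) / norm (x - p))
          \<le> \<bar>c x - c p\<bar> * (q x + \<bar>K\<bar>)"
        by (auto simp: eventually_at_filter)
    qed
  qed simp
  from has_derivative_add[OF has_derivative_mult_right[OF g, of "c p"] this]
  show ?thesis by (simp add: algebra_simps)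
qed

lemma has_vector_derivative_quotient:
  assumes "(f has_vector_derivative D) (at (0::real))"
  shows "((\<lambda>t. (1 / t) *\<^sub>R (f t - f 0)) \<longlongrightarrow> D) (at 0)"
proof -
  have "((\<lambda>h. norm (f h - f 0 - h *\<^sub>R D) / norm h) \<longlongrightarrow> 0) (at 0)"
    using assms unfolding has_vector_derivative_def has_derivative_iff_norm by simp
  moreover have "norm (f h - f 0 - h *\<^sub>R D) / norm h = norm ((1 / h) *\<^sub>R (f h - f 0) - D)" if "h \<noteq> 0" for h
  proof -
    have "(1 / h) *\<^sub>R (f h - f 0) - D = (1 / h) *\<^sub>R (f h - f 0 - h *\<^sub>R D)"
      using that by (simp add: scaleR_diff_right)
    then show ?thesis by simp
  qed
  ultimately have "((\<lambda>h. norm ((1 / h) *\<^sub>R (f h - f 0) - D)) \<longlongrightarrow> 0) (at 0)"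
    by (simp cong: Lim_cong_within)
  then show ?thesis by (rule LIM_zero_cancel[OF tendsto_norm_zero_cancel])
qed

text \<open>Taylor's formula with the second derivative known at 0 only. The derivative of the
  remainder \<open>F\<close> is small compared with \<open>t\<close>, and the mean value inequality
  on the segment from 0 to \<open>t\<close> makes \<open>F\<close> small compared with
  \<open>t\<^sup>2\<close>.\<close>

lemma second_order_quotient:
  fixes g g' :: "real \<Rightarrow> 'a::real_normed_vector"
  assumes J: "open J" "0 \<in> J" and g: "\<And>t. t \<in> J \<Longrightarrow> (g has_vector_derivative g' t) (at t)"
    and g': "(g' has_vector_derivative D) (at 0)" and 0: "g 0 = 0"
  shows "((\<lambda>t. (1 / t\<^sup>2) *\<^sub>R (g t - t *\<^sub>R g' 0)) \<longlongrightarrow> (1/2) *\<^sub>R D) (at 0)"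
proof (rule LIM_zero_cancel, rule tendstoI)
  fix e :: real assume e: "e > 0"
  have "((\<lambda>t. (1 / t) *\<^sub>R (g' t - g' 0)) \<longlongrightarrow> D) (at 0)"
    by (rule has_vector_derivative_quotient[OF g'])
  \<comment> \<open>Half of \<open>e\<close> is kept in reserve, since the mean value inequality
    yields only a non-strict bound.\<close>
  then have "\<forall>\<^sub>F t in at 0. dist ((1 / t) *\<^sub>R (g' t - g' 0)) D < e / 2"
    by (rule tendstoD) (use e in simp)
  moreover have "\<forall>\<^sub>F t in at 0. t \<in> J" using J by (simp add: eventually_at_in_open')
  ultimately have "\<forall>\<^sub>F t in at 0. dist ((1 / t) *\<^sub>R (g' t - g' 0)) D < e / 2 \<and> t \<in> J" by eventually_elim simp
  then obtain d where d: "d > 0"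
    "\<And>t. t \<noteq> 0 \<Longrightarrow> \<bar>t\<bar> < d \<Longrightarrow> dist ((1 / t) *\<^sub>R (g' t - g' 0)) D < e / 2 \<and> t \<in> J"
    unfolding eventually_at by auto
  define F where "F = (\<lambda>t. g t - t *\<^sub>R g' 0 - (t\<^sup>2 / 2) *\<^sub>R D)"
  define F' where "F' = (\<lambda>t. g' t - g' 0 - t *\<^sub>R D)"
  have dF: "(F has_vector_derivative F' t) (at t)" if "t \<in> J" for t
    unfolding F_def F'_def
    by (rule derivative_eq_intros g[OF that] | simp)+
  have bF: "norm (F' t) \<le> e / 2 * \<bar>t\<bar>" if "\<bar>t\<bar> < d" for t
  proof (cases "t = 0")
    case False
    have "F' t = t *\<^sub>R ((1 / t) *\<^sub>R (g' t - g' 0) - D)"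
      using False by (simp add: F'_def scaleR_diff_right)
    then have "norm (F' t) = \<bar>t\<bar> * dist ((1 / t) *\<^sub>R (g' t - g' 0)) D" by (simp add: dist_norm)
    also have "\<dots> \<le> \<bar>t\<bar> * (e / 2)" using d(2)[OF False that] by (intro mult_left_mono) auto
    finally show ?thesis by (simp add: mult.commute)
  qed (simp add: F'_def)
  have "dist ((1 / t\<^sup>2) *\<^sub>R (g t - t *\<^sub>R g' 0) - (1/2) *\<^sub>R D) 0 < e" if t: "t \<noteq> 0" "\<bar>t\<bar> < d" for t
  proof -
    have seg: "\<bar>s\<bar> \<le> \<bar>t\<bar>" if "s \<in> closed_segment 0 t" for s
      using that by (auto simp: closed_segment_eq_real_ivl split: if_splits)
    have sJ: "s \<in> J" if "s \<in> closed_segment 0 t" for s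
      using seg[OF that] d(2)[of s] t J by (cases "s = 0") auto
    have "norm (F t - F 0 - (t - 0) *\<^sub>R F' 0) \<le> norm (t - 0) * (e / 2 * \<bar>t\<bar>)"
    proof (rule vector_differentiable_bound_linearization[of "closed_segment 0 t"])
      show "(F has_vector_derivative F' s) (at s within closed_segment 0 t)" if "s \<in> closed_segment 0 t" for s
        using dF[OF sJ[OF that]] by (rule has_vector_derivative_at_within)
      show "norm (F' s - F' 0) \<le> e / 2 * \<bar>t\<bar>" if "s \<in> closed_segment 0 t" for s
      proof -
        have "norm (F' s) \<le> e / 2 * \<bar>s\<bar>" using bF seg[OF that] t by simp
        also have "\<dots> \<le> e / 2 * \<bar>t\<bar>" using seg[OF that] e by simp
        finally show ?thesis by (simp add: F'_def)
      qed
    qed auto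
    then have "norm (F t) \<le> \<bar>t\<bar> * (e / 2 * \<bar>t\<bar>)" using 0 by (simp add: F_def F'_def)
    also have "\<dots> = \<bar>t\<bar>\<^sup>2 * (e / 2)" by (simp only: power2_eq_square mult_ac)
    finally have "norm (F t) \<le> t\<^sup>2 * (e / 2)" by simp
    moreover have "(1 / t\<^sup>2) *\<^sub>R (g t - t *\<^sub>R g' 0) - (1/2) *\<^sub>R D = (1 / t\<^sup>2) *\<^sub>R F t"
      using t by (simp add: F_def scaleR_diff_right)
    ultimately have "norm ((1 / t\<^sup>2) *\<^sub>R (g t - t *\<^sub>R g' 0) - (1/2) *\<^sub>R D) \<le> e / 2"
      using t by (simp add: field_simps)
    then show ?thesis using e by simp
  qed
  then show "\<forall>\<^sub>F t in at 0. dist ((1 / t\<^sup>2) *\<^sub>R (g t - t *\<^sub>R g' 0) - (1/2) *\<^sub>R D) 0 < e"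
    unfolding eventually_at using d(1) by (metis UNIV_I dist_0_norm dist_commute real_norm_def)
qed

text \<open>Writing \<open>g' = t (g''(0) + t u)\<close> and \<open>g'' = g''(0) + t w\<close> with
  \<open>u \<rightarrow> g'''(0)/2\<close> and \<open>w \<rightarrow> g'''(0)\<close>, the determinant is
  \<open>t\<^sup>2 (1 - 1/2) det (g''(0), g'''(0), n(0))\<close> to leading order.\<close>

lemma curvature_quotient_limit:
  fixes g n :: "real \<Rightarrow> real^3"
  assumes J: "open J" "0 \<in> J" and g: "smooth_on J g" and g1: "vderiv g 0 = 0" and n: "isCont n 0"
    and D: "det3 ((vderiv ^^ 2) g 0) ((vderiv ^^ 3) g 0) (n 0) \<noteq> 0" (is "?D \<noteq> 0")
  shows "((\<lambda>t. \<bar>t\<bar> * (det3 (vderiv g t) ((vderiv ^^ 2) g t) (n t) / norm (vderiv g t) ^ 3))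
    \<longlongrightarrow> ?D / (2 * norm ((vderiv ^^ 2) g 0) ^ 3)) (at 0)"
proof -
  define g1 where "g1 = vderiv g"
  define g2 where "g2 = vderiv g1"
  define g3 where "g3 = vderiv g2"
  have eqs: "(vderiv ^^ 2) g = g2" "(vderiv ^^ 3) g = g3"
    by (simp_all add: g1_def g2_def g3_def numeral_2_eq_2 numeral_3_eq_3)
  have s1: "smooth_on J g1" unfolding g1_def by (rule smooth_on_vderiv(1)[OF g J(1)])
  have s2: "smooth_on J g2" unfolding g2_def by (rule smooth_on_vderiv(1)[OF s1 J(1)])
  have d2: "(g1 has_vector_derivative g2 t) (at t)" if "t \<in> J" for t
    using smooth_on_vderiv(2)[OF s1 J(1) that] by (simp add: g2_def)
  have d3: "(g2 has_vector_derivative g3 0) (at 0)"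
    using smooth_on_vderiv(2)[OF s2 J(1) J(2)] by (simp add: g3_def)
  have g10: "g1 0 = 0" using g1 by (simp add: g1_def)
  define u where "u = (\<lambda>t. (1 / t\<^sup>2) *\<^sub>R (g1 t - t *\<^sub>R g2 0))"
  define w where "w = (\<lambda>t. (1 / t) *\<^sub>R (g2 t - g2 0))"
  define p where "p = (\<lambda>t. g2 0 + t *\<^sub>R u t)"
  \<comment> \<open>\<open>E\<close> is the determinant divided by \<open>t\<^sup>2\<close>: the
    lower-order term contains \<open>g2 0\<close> twice and drops out.\<close>
  define E where "E = (\<lambda>t. det3 (g2 0) (w t) (n t) + det3 (u t) (g2 0) (n t) + t * det3 (u t) (w t) (n t))"
  have u: "(u \<longlongrightarrow> (1/2) *\<^sub>R g3 0) (at 0)"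
    unfolding u_def by (rule second_order_quotient[OF J d2 d3 g10])
  have w: "(w \<longlongrightarrow> g3 0) (at 0)"
    unfolding w_def by (rule has_vector_derivative_quotient[OF d3])
  have n: "(n \<longlongrightarrow> n 0) (at 0)" using n by (simp add: isCont_def)
  have p: "(p \<longlongrightarrow> g2 0) (at 0)"
    unfolding p_def by (rule tendsto_eq_intros u refl | simp)+
  have "(E \<longlongrightarrow> det3 (g2 0) (g3 0) (n 0) + det3 ((1/2) *\<^sub>R g3 0) (g2 0) (n 0)
      + 0 * det3 ((1/2) *\<^sub>R g3 0) (g3 0) (n 0)) (at 0)"
    unfolding E_def by (intro tendsto_intros u w n)
  moreover have "det3 (g2 0) (g3 0) (n 0) + det3 ((1/2) *\<^sub>R g3 0) (g2 0) (n 0)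
      + 0 * det3 ((1/2) *\<^sub>R g3 0) (g3 0) (n 0) = ?D / 2"
    by (simp add: eqs det3_expand field_simps)
  ultimately have E: "(E \<longlongrightarrow> ?D / 2) (at 0)" by (simp only:)
  have g20: "g2 0 \<noteq> 0" using D by (auto simp: eqs det3_expand)
  have g1p: "g1 t = t *\<^sub>R p t" and g2w: "g2 t = g2 0 + t *\<^sub>R w t" if "t \<noteq> 0" for t
    using that by (simp_all add: p_def u_def w_def scaleR_add_right power2_eq_square)
  have "((\<lambda>t. E t / norm (p t) ^ 3) \<longlongrightarrow> (?D / 2) / norm (g2 0) ^ 3) (at 0)"
    using g20 by (intro tendsto_intros E p) simp
  moreover have "E t / norm (p t) ^ 3 =
      \<bar>t\<bar> * (det3 (vderiv g t) ((vderiv ^^ 2) g t) (n t) / norm (vderiv g t) ^ 3)" if t: "t \<noteq> 0" for t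
  proof -
    have "det3 (g1 t) (g2 t) (n t) = t\<^sup>2 * E t"
      unfolding g1p[OF t] g2w[OF t] p_def E_def det3_expand
      by (simp add: algebra_simps power2_eq_square)
    \<comment> \<open>The cube of \<bar>t\<bar> is split so that \<open>t\<^sup>2\<close> cancels
      against the determinant and the remaining factor against the \<bar>t\<bar> in the
      claim.\<close>
    moreover have "norm (g1 t) ^ 3 = \<bar>t\<bar> * t\<^sup>2 * norm (p t) ^ 3"
      unfolding g1p[OF t] by (simp add: power_mult_distrib power3_eq_cube power2_eq_square)
    ultimately have "\<bar>t\<bar> * (det3 (g1 t) (g2 t) (n t) / norm (g1 t) ^ 3) = E t / norm (p t) ^ 3"
      using t by simp
    then show ?thesis by (simp add: eqs g1_def)
  qed
  then have "\<forall>\<^sub>F t in at 0. E t / norm (p t) ^ 3 =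
      \<bar>t\<bar> * (det3 (vderiv g t) ((vderiv ^^ 2) g t) (n t) / norm (vderiv g t) ^ 3)"
    by (simp add: eventually_at_filter)
  ultimately show "((\<lambda>t. \<bar>t\<bar> * (det3 (vderiv g t) ((vderiv ^^ 2) g t) (n t) / norm (vderiv g t) ^ 3))
    \<longlongrightarrow> ?D / (2 * norm ((vderiv ^^ 2) g 0) ^ 3)) (at 0)"
    by (subst (asm) tendsto_cong) (simp_all add: eqs)
qed

section \<open>The separated form of a front\<close>

lemma has_derivative_vec_nth [derivative_intros]:
  "(f has_derivative f') F \<Longrightarrow> ((\<lambda>x. f x $ i) has_derivative (\<lambda>X. f' X $ i)) F"
  by (rule bounded_linear.has_derivative[OF bounded_linear_vec_nth])

lemma vector3_axis_sum: "(vector [a, b, c] :: real^3) = a *\<^sub>R axis 1 1 + b *\<^sub>R axis 2 1 + c *\<^sub>R axis 3 1"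
  by (simp add: vec_eq_iff forall_3 axis_def)

lemma D4_plus_separated_form_derivative:
  "(D4_plus_separated_form has_derivative
     (\<lambda>X. vector [2 * y$1 * X$1, 2 * y$2 * X$2, 3 * (y$1)\<^sup>2 * X$1 - 3 * (y$2)\<^sup>2 * X$2])) (at y)"
  unfolding D4_plus_separated_form_def[abs_def] vector3_axis_sum
  by (rule derivative_eq_intros | simp)+ (simp add: fun_eq_iff power2_eq_square mult_ac)

lemma smooth_on_D4_plus_separated_form: "smooth_on UNIV D4_plus_separated_form"
  unfolding D4_plus_separated_form_def[abs_def]
  by (intro smooth_on_vector3 smooth_on_diff smooth_on_power smooth_on_nth smooth_on_id open_UNIV)

text \<open>Differentiating \<open>S' (S x) = x\<close> exhibits a left inverse of the derivative of
  \<open>S\<close>.\<close>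

lemma inj_frechet_derivative_left_inverse:
  assumes "open U" "x \<in> U" "smooth_on U S" "smooth_on V S'" "S x \<in> V" "\<And>x. x \<in> U \<Longrightarrow> S' (S x) = x"
    and "frechet_derivative S (at x) X = 0"
  shows "X = 0"
proof -
  have "((\<lambda>x. S' (S x)) has_derivative
      (\<lambda>X. frechet_derivative S' (at (S x)) (frechet_derivative S (at x) X))) (at x)"
    by (rule has_derivative_compose[OF smooth_on_has_derivative smooth_on_has_derivative]) (use assms in auto)
  then have "((\<lambda>x. x) has_derivative
      (\<lambda>X. frechet_derivative S' (at (S x)) (frechet_derivative S (at x) X))) (at x)"
    by (rule has_derivative_transform_within_open[OF _ assms(1,2)]) (use assms in simp)
  then have "(\<lambda>X. frechet_derivative S' (at (S x)) (frechet_derivative S (at x) X)) = (\<lambda>X. X)"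
    using has_derivative_ident has_derivative_unique by blast
  moreover have "linear (frechet_derivative S' (at (S x)))"
    using smooth_on_has_derivative[OF assms(4,5)] by (rule has_derivative_linear)
  ultimately show ?thesis using assms(7) linear_0 by metis
qed

lemma vec2_axis_sum: "(X::real^2) = X$1 *\<^sub>R axis 1 1 + X$2 *\<^sub>R axis 2 1"
  by (simp add: vec_eq_iff forall_2 axis_def)

text \<open>\<open>\<Psi>\<close> plays the role of a local inverse of the target coordinate change,
  so \<open>f\<close> is a composite through the separated form. Of the diffeomorphism property,
  smoothness and injectivity of the derivatives are recorded.\<close>

locale separated_front =
  fixes f \<nu> :: "real^2 \<Rightarrow> real^3" and \<Phi> :: "real^2 \<Rightarrow> real^2" and \<Psi> :: "real^3 \<Rightarrow> real^3"
    and W :: "(real^2) set" and V :: "(real^3) set"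
  assumes open_W: "open W" and zero_W: "0 \<in> W" and open_V: "open V"
    and smooth_\<Phi>: "smooth_on W \<Phi>" and smooth_\<Psi>: "smooth_on V \<Psi>"
    and maps: "\<And>x. x \<in> W \<Longrightarrow> D4_plus_separated_form (\<Phi> x) \<in> V"
    and f_eq: "\<And>x. x \<in> W \<Longrightarrow> f x = \<Psi> (D4_plus_separated_form (\<Phi> x))"
    and inj_\<Phi>: "\<And>x X. x \<in> W \<Longrightarrow> frechet_derivative \<Phi> (at x) X = 0 \<Longrightarrow> X = 0"
    and inj_\<Psi>: "\<And>y X. y \<in> V \<Longrightarrow> frechet_derivative \<Psi> (at y) X = 0 \<Longrightarrow> X = 0"
    and \<Phi>_0: "\<Phi> 0 = 0"
    and cont_\<nu>: "continuous_on W \<nu>"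
    and norm_\<nu>: "\<And>x. x \<in> W \<Longrightarrow> norm (\<nu> x) = 1"
    and orth_\<nu>: "\<And>x X. x \<in> W \<Longrightarrow> frechet_derivative f (at x) X \<bullet> \<nu> x = 0"
begin

definition "d\<Phi> x X = frechet_derivative \<Phi> (at x) X"

text \<open>The partial derivatives of the separated form are its coordinates \<open>a\<close> and
  \<open>b\<close> times \<open>(2, 0, 3 a)\<close> and \<open>(0, 2, -3 b)\<close>.
  \<open>P\<close> and \<open>Q\<close> are the images of these quotients, which stay independent
  even where \<open>a\<close> or \<open>b\<close> vanishes.\<close>

definition "P x = frechet_derivative \<Psi> (at (D4_plus_separated_form (\<Phi> x))) (vector [2, 0, 3 * \<Phi> x $ 1])"

definition "Q x = frechet_derivative \<Psi> (at (D4_plus_separated_form (\<Phi> x))) (vector [0, 2, - 3 * \<Phi> x $ 2])"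

definition "jac x = d\<Phi> x (axis 1 1) $ 1 * d\<Phi> x (axis 2 1) $ 2 - d\<Phi> x (axis 2 1) $ 1 * d\<Phi> x (axis 1 1) $ 2"

definition "\<Delta> x = det3 (P x) (Q x) (\<nu> x)"

lemma \<Phi>_derivative: "x \<in> W \<Longrightarrow> (\<Phi> has_derivative d\<Phi> x) (at x)"
  unfolding d\<Phi>_def using smooth_on_has_derivative[OF smooth_\<Phi>] .

lemma linear_d\<Phi>: "x \<in> W \<Longrightarrow> linear (d\<Phi> x)"
  using \<Phi>_derivative has_derivative_linear by blast

lemma d\<Phi>_expand:
  assumes "x \<in> W"
  shows "d\<Phi> x X = X$1 *\<^sub>R d\<Phi> x (axis 1 1) + X$2 *\<^sub>R d\<Phi> x (axis 2 1)"
proof -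
  have "d\<Phi> x X = d\<Phi> x (X$1 *\<^sub>R axis 1 1 + X$2 *\<^sub>R axis 2 1)" by (simp only: vec2_axis_sum[symmetric])
  then show ?thesis using linear_d\<Phi>[OF assms] by (simp only: linear_add linear_scale)
qed

lemma linear_d\<Psi>: "y \<in> V \<Longrightarrow> linear (frechet_derivative \<Psi> (at y))"
  using smooth_on_has_derivative[OF smooth_\<Psi>] has_derivative_linear by blast

text \<open>Multiplicativity of the determinant. It converts the orientation of a frame in the
  source into signs of the coordinate differentials.\<close>

lemma jac_det:
  assumes "x \<in> W"
  shows "jac x * det2 X Y = d\<Phi> x X $ 1 * d\<Phi> x Y $ 2 - d\<Phi> x Y $ 1 * d\<Phi> x X $ 2"
  unfolding d\<Phi>_expand[OF assms, of X] d\<Phi>_expand[OF assms, of Y] jac_def det2_expand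
  by (simp add: algebra_simps)

lemma jac_nonzero:
  assumes "x \<in> W" shows "jac x \<noteq> 0"
proof
  assume 0: "jac x = 0"
  let ?a = "d\<Phi> x (axis 1 1)" and ?b = "d\<Phi> x (axis 2 1)"
  have zero: "X = 0" if "d\<Phi> x X = 0" for X using inj_\<Phi>[OF assms] that by (simp add: d\<Phi>_def)
  \<comment> \<open>These are the two rows of the Jacobian matrix turned by a right angle. A
    vanishing determinant puts both in the kernel, so all entries vanish.\<close>
  have "d\<Phi> x (vector [?b $ 1, - ?a $ 1]) = 0" "d\<Phi> x (vector [?b $ 2, - ?a $ 2]) = 0"
    using 0 d\<Phi>_expand[OF assms, of "vector [?b $ 1, - ?a $ 1]"] d\<Phi>_expand[OF assms, of "vector [?b $ 2, - ?a $ 2]"]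
    by (simp_all add: jac_def vec_eq_iff forall_2 algebra_simps)
  from this[THEN zero] have "?a = 0"
    by (simp add: vec_eq_iff forall_2)
  then have "axis 1 1 = (0 :: real^2)" by (rule zero)
  then show False by (simp add: axis_eq_0_iff)
qed

lemma f_derivative:
  assumes "x \<in> W"
  shows "(f has_derivative (\<lambda>X. (\<Phi> x $ 1 * d\<Phi> x X $ 1) *\<^sub>R P x + (\<Phi> x $ 2 * d\<Phi> x X $ 2) *\<^sub>R Q x)) (at x)"
proof -
  let ?y = "D4_plus_separated_form (\<Phi> x)"
  let ?L = "frechet_derivative \<Psi> (at ?y)"
  let ?h = "\<lambda>X. vector [2 * \<Phi> x $ 1 * X$1, 2 * \<Phi> x $ 2 * X$2, 3 * (\<Phi> x $ 1)\<^sup>2 * X$1 - 3 * (\<Phi> x $ 2)\<^sup>2 * X$2] :: real^3"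
  have "((\<lambda>x. \<Psi> (D4_plus_separated_form (\<Phi> x))) has_derivative (\<lambda>X. ?L (?h (d\<Phi> x X)))) (at x)"
    by (rule has_derivative_compose[OF has_derivative_compose[OF \<Phi>_derivative[OF assms]
            D4_plus_separated_form_derivative] smooth_on_has_derivative[OF smooth_\<Psi> maps[OF assms]]])
  then have d: "(f has_derivative (\<lambda>X. ?L (?h (d\<Phi> x X)))) (at x)"
    by (rule has_derivative_transform_within_open[OF _ open_W assms]) (simp add: f_eq)
  have "?h Y = (\<Phi> x $ 1 * Y $ 1) *\<^sub>R vector [2, 0, 3 * \<Phi> x $ 1]
      + (\<Phi> x $ 2 * Y $ 2) *\<^sub>R vector [0, 2, - 3 * \<Phi> x $ 2]" for Y :: "real^2"
    by (simp add: vec_eq_iff forall_3 power2_eq_square)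
  then have "?L (?h Y) = (\<Phi> x $ 1 * Y $ 1) *\<^sub>R P x + (\<Phi> x $ 2 * Y $ 2) *\<^sub>R Q x" for Y :: "real^2"
    using linear_d\<Psi>[OF maps[OF assms]] by (simp only: linear_add linear_scale P_def Q_def)
  then show ?thesis using d by simp
qed

lemma f_frechet:
  "x \<in> W \<Longrightarrow> frechet_derivative f (at x) X
    = (\<Phi> x $ 1 * d\<Phi> x X $ 1) *\<^sub>R P x + (\<Phi> x $ 2 * d\<Phi> x X $ 2) *\<^sub>R Q x"
  by (simp add: frechet_derivative_at[OF f_derivative, symmetric])

text \<open>The first two components of the vectors behind \<open>P\<close> and \<open>Q\<close> are
  already independent, and the derivative of \<open>\<Psi>\<close> is injective.\<close>

lemma PQ_independent:
  assumes "x \<in> W" "s *\<^sub>R P x + t *\<^sub>R Q x = 0"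
  shows "s = 0 \<and> t = 0"
proof -
  let ?v = "s *\<^sub>R vector [2, 0, 3 * \<Phi> x $ 1] + t *\<^sub>R vector [0, 2, - 3 * \<Phi> x $ 2] :: real^3"
  have "frechet_derivative \<Psi> (at (D4_plus_separated_form (\<Phi> x))) ?v = 0"
    using assms linear_d\<Psi>[OF maps[OF assms(1)]] by (simp only: linear_add linear_scale P_def Q_def)
  then have "?v = 0" by (rule inj_\<Psi>[OF maps[OF assms(1)]])
  then show ?thesis by (simp add: vec_eq_iff forall_3)
qed

text \<open>Where neither coordinate vanishes, independence of \<open>P\<close> and \<open>Q\<close>
  makes the derivative of \<open>f\<close> injective, hence of rank 2.\<close>

lemma singular_zero:
  assumes "x \<in> W" "x \<in> singular_set f"
  shows "\<Phi> x $ 1 * \<Phi> x $ 2 = 0"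
proof (rule ccontr)
  assume n: "\<Phi> x $ 1 * \<Phi> x $ 2 \<noteq> 0"
  have lin: "linear (frechet_derivative f (at x))"
    using has_derivative_linear[OF f_derivative[OF assms(1)]]
    by (simp add: frechet_derivative_at[OF f_derivative[OF assms(1)], symmetric])
  have "X = 0" if "frechet_derivative f (at x) X = 0" for X
  proof -
    have "\<Phi> x $ 1 * d\<Phi> x X $ 1 = 0 \<and> \<Phi> x $ 2 * d\<Phi> x X $ 2 = 0"
      using that PQ_independent[OF assms(1)] by (simp only: f_frechet[OF assms(1)])
    then have "d\<Phi> x X = 0" using n by (simp add: vec_eq_iff forall_2)
    then show ?thesis using inj_\<Phi>[OF assms(1)] by (simp add: d\<Phi>_def)
  qed
  then have "inj (frechet_derivative f (at x))" using linear_injective_0[OF lin] by blast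
  moreover have "(*v) (jacobian f (at x)) = frechet_derivative f (at x)"
    using lin by (simp add: jacobian_def fun_eq_iff matrix_works)
  ultimately have "rank (jacobian f (at x)) = 2" using full_rank_injective[of "jacobian f (at x)"] by simp
  then show False using assms(2) by (simp add: singular_set_def)
qed

lemma continuous_on_d\<Psi>:
  "continuous_on W (\<lambda>x. frechet_derivative \<Psi> (at (D4_plus_separated_form (\<Phi> x))) v)"
proof -
  have "continuous_on V (\<lambda>y. frechet_derivative \<Psi> (at y) v)"
    by (rule smooth_on_continuous_on[OF smooth_on_frechet_derivative[OF smooth_\<Psi>]])
  moreover have "continuous_on W (\<lambda>x. D4_plus_separated_form (\<Phi> x))"
    by (rule continuous_on_compose2[OF smooth_on_continuous_on[OF smooth_on_D4_plus_separated_form]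
          smooth_on_continuous_on[OF smooth_\<Phi>]]) simp
  ultimately show ?thesis using maps by (auto intro: continuous_on_compose2)
qed

lemma continuous_PQ: "continuous_on W P" "continuous_on W Q"
proof -
  note c = continuous_on_d\<Psi> smooth_on_continuous_on[OF smooth_\<Phi>]
  \<comment> \<open>In the definitions the direction varies with \<open>x\<close>; linearity reduces
    to fixed directions with continuous coefficients.\<close>
  have "P x = frechet_derivative \<Psi> (at (D4_plus_separated_form (\<Phi> x))) (2 *\<^sub>R axis 1 1)
      + (3 * \<Phi> x $ 1) *\<^sub>R frechet_derivative \<Psi> (at (D4_plus_separated_form (\<Phi> x))) (axis 3 1)"
    "Q x = frechet_derivative \<Psi> (at (D4_plus_separated_form (\<Phi> x))) (2 *\<^sub>R axis 2 1)
      + (- 3 * \<Phi> x $ 2) *\<^sub>R frechet_derivative \<Psi> (at (D4_plus_separated_form (\<Phi> x))) (axis 3 1)"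
    if "x \<in> W" for x
    unfolding P_def Q_def vector3_axis_sum
    using linear_d\<Psi>[OF maps[OF that]] by (simp_all only: linear_add linear_scale) simp_all
  then show "continuous_on W P" "continuous_on W Q"
    by (simp_all cong: continuous_on_cong) (intro continuous_intros c)+
qed

lemma isCont_\<Delta>: "x \<in> W \<Longrightarrow> isCont \<Delta> x"
  using continuous_PQ cont_\<nu> open_W
  unfolding \<Delta>_def[abs_def] isCont_def continuous_on_eq_continuous_at[OF open_W]
  by (intro tendsto_intros) (simp_all add: isCont_def)

lemma isCont_jac: "x \<in> W \<Longrightarrow> isCont jac x"
proof -
  have "continuous_on W (\<lambda>x. d\<Phi> x v)" for v
    unfolding d\<Phi>_def by (rule smooth_on_continuous_on[OF smooth_on_frechet_derivative[OF smooth_\<Phi>]])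
  then have "continuous_on W jac"
    unfolding jac_def[abs_def] by (intro continuous_intros)
  then show "x \<in> W \<Longrightarrow> isCont jac x" using continuous_on_eq_continuous_at[OF open_W] by blast
qed

text \<open>Orthogonality of \<nu> to the images of the two basis vectors is a linear system for
  these products with determinant \<open>jac x\<close>, so Cramer's rule gives zero.\<close>

lemma \<Phi>_orthogonal:
  assumes "x \<in> W"
  shows "(P x \<bullet> \<nu> x) * \<Phi> x $ 1 = 0" "(Q x \<bullet> \<nu> x) * \<Phi> x $ 2 = 0"
proof -
  have eq: "d\<Phi> x X $ 1 * (P x \<bullet> \<nu> x * \<Phi> x $ 1) + d\<Phi> x X $ 2 * (Q x \<bullet> \<nu> x * \<Phi> x $ 2) = 0" for X
    using orth_\<nu>[OF assms, of X] by (simp add: f_frechet[OF assms] inner_add_left algebra_simps)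
  let ?a = "d\<Phi> x (axis 1 1)" and ?b = "d\<Phi> x (axis 2 1)"
  have "jac x * (P x \<bullet> \<nu> x * \<Phi> x $ 1) = 0" "jac x * (Q x \<bullet> \<nu> x * \<Phi> x $ 2) = 0"
    using eq[of "axis 1 1"] eq[of "axis 2 1"] unfolding jac_def by algebra+
  then show "(P x \<bullet> \<nu> x) * \<Phi> x $ 1 = 0" "(Q x \<bullet> \<nu> x) * \<Phi> x $ 2 = 0"
    using jac_nonzero[OF assms] by simp_all
qed

text \<open>At the origin both coordinates vanish, and orthogonality is recovered by differentiating
  the products.\<close>

lemma factor_zero_at_0:
  assumes c: "isCont c 0" and z: "\<And>x. x \<in> W \<Longrightarrow> c x * \<Phi> x $ i = (0::real)"
  shows "c 0 = 0"
proof (rule ccontr)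
  assume n: "c 0 \<noteq> 0"
  have "((\<lambda>x. c x * \<Phi> x $ i) has_derivative (\<lambda>X. c 0 * d\<Phi> 0 X $ i)) (at 0)"
    by (rule has_derivative_mult_zero[OF c has_derivative_vec_nth[OF \<Phi>_derivative[OF zero_W]]])
      (simp add: \<Phi>_0)
  then have "((\<lambda>x. 0) has_derivative (\<lambda>X. c 0 * d\<Phi> 0 X $ i)) (at 0)"
    by (rule has_derivative_transform_within_open[OF _ open_W zero_W]) (use z in simp)
  then have "(\<lambda>X. c 0 * d\<Phi> 0 X $ i) = (\<lambda>X. 0)"
    using has_derivative_const has_derivative_unique by blast
  then have "d\<Phi> 0 X $ i = 0" for X using n by (metis mult_eq_0_iff)
  \<comment> \<open>One row of the Jacobian matrix at 0 would vanish.\<close>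
  then have "jac 0 = 0" using exhaust_2[of i] by (auto simp: jac_def)
  then show False using jac_nonzero[OF zero_W] by simp
qed

lemma \<Delta>_nonzero: "\<Delta> 0 \<noteq> 0"
proof -
  have ic: "isCont P 0" "isCont Q 0" "isCont \<nu> 0"
    using continuous_PQ cont_\<nu> zero_W by (simp_all add: continuous_on_eq_continuous_at[OF open_W])
  have "P 0 \<bullet> \<nu> 0 = 0" "Q 0 \<bullet> \<nu> 0 = 0"
    by (rule factor_zero_at_0[OF isCont_inner[OF ic(1,3)] \<Phi>_orthogonal(1)]
        factor_zero_at_0[OF isCont_inner[OF ic(2,3)] \<Phi>_orthogonal(2)], assumption)+
  moreover have "\<nu> 0 \<noteq> 0" using norm_\<nu>[OF zero_W] by auto
  ultimately show ?thesis
    unfolding \<Delta>_def by (intro det3_orthogonal_nonzero) (use PQ_independent[OF zero_W] in auto)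
qed

lemma signed_area_density_eq:
  assumes "x \<in> W"
  shows "signed_area_density f \<nu> x = \<Phi> x $ 1 * jac x * \<Delta> x * \<Phi> x $ 2"
  unfolding signed_area_density_def f_frechet[OF assms] \<Delta>_def jac_def det3_expand
  by (simp add: algebra_simps)

text \<open>The second coordinate is the vanishing factor of the area density here, so continuity of
  the remaining product suffices for the product rule.\<close>

lemma signed_area_density_derivative:
  assumes "x \<in> W" "\<Phi> x $ 2 = 0"
  shows "frechet_derivative (signed_area_density f \<nu>) (at x) X = \<Phi> x $ 1 * jac x * \<Delta> x * d\<Phi> x X $ 2"
proof -
  have "isCont (\<lambda>x. \<Phi> x $ 1 * jac x * \<Delta> x) x"
    using isCont_\<Delta>[OF assms(1)] isCont_jac[OF assms(1)] has_derivative_continuous[OF \<Phi>_derivative[OF assms(1)]]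
    by (intro continuous_intros) auto
  from has_derivative_mult_zero[OF this has_derivative_vec_nth[OF \<Phi>_derivative[OF assms(1)]] assms(2)]
  have "(signed_area_density f \<nu> has_derivative (\<lambda>X. \<Phi> x $ 1 * jac x * \<Delta> x * d\<Phi> x X $ 2)) (at x)"
    by (rule has_derivative_transform_within_open[OF _ open_W assms(1)]) (simp add: signed_area_density_eq)
  then show ?thesis using frechet_derivative_at by metis
qed

end

section \<open>The singular curvature\<close>

lemma filterlim_pole_of_order_one:
  fixes c K :: "real \<Rightarrow> real"
  assumes c: "(c \<longlongrightarrow> c0) (at 0)" "c0 > 0" and K: "\<forall>\<^sub>F t in at 0. K t = c t * inverse t"
  shows "filterlim K at_top (at_right 0)" "filterlim K at_bot (at_left 0)"
proof -
  have le: "at_right 0 \<le> at (0::real)" "at_left 0 \<le> at (0::real)" by (simp_all add: at_le)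
  have "filterlim (\<lambda>t. c t * inverse t) at_top (at_right 0)"
    by (rule filterlim_tendsto_pos_mult_at_top[OF tendsto_mono[OF le(1) c(1)] c(2) filterlim_inverse_at_top_right])
  then show "filterlim K at_top (at_right 0)"
    unfolding filterlim_cong[OF refl refl filter_leD[OF le(1) K]] .
  have "filterlim (\<lambda>t. c t * inverse t) at_bot (at_left 0)"
    by (rule filterlim_tendsto_pos_mult_at_bot[OF tendsto_mono[OF le(2) c(1)] c(2) filterlim_inverse_at_bot_neg])
  then show "filterlim K at_bot (at_left 0)"
    unfolding filterlim_cong[OF refl refl filter_leD[OF le(2) K]] .
qed

lemma filterlim_pole_of_order_one_cases:
  fixes c K :: "real \<Rightarrow> real"
  assumes c: "(c \<longlongrightarrow> c0) (at 0)" "c0 \<noteq> 0" and K: "\<forall>\<^sub>F t in at 0. K t = c t * inverse t"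
  shows "filterlim K at_top (at_right 0) \<and> filterlim K at_bot (at_left 0) \<or>
    filterlim K at_bot (at_right 0) \<and> filterlim K at_top (at_left 0)"
proof (cases "c0 > 0")
  case True
  then show ?thesis using filterlim_pole_of_order_one[OF c(1) _ K] by simp
next
  case False
  have "\<forall>\<^sub>F t in at 0. - K t = - c t * inverse t" using K by eventually_elim simp
  from filterlim_pole_of_order_one[OF tendsto_minus[OF c(1)] _ this] False c(2)
  have "filterlim (\<lambda>t. - K t) at_top (at_right 0)" "filterlim (\<lambda>t. - K t) at_bot (at_left 0)" by simp_all
  then show ?thesis
    using filterlim_uminus_at_bot[of K "at_right 0"] filterlim_uminus_at_top[of K "at_left 0"] by blast
qed

context separated_front
begin

section \<open>Singular curves on which the first coordinate has nonzero speed at the origin\<close>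

context
  fixes \<gamma> :: "real \<Rightarrow> real^2" and J :: "real set"
  assumes J: "open J" "0 \<in> J" and smooth_\<gamma>: "smooth_on J \<gamma>" and \<gamma>_W: "\<gamma> ` J \<subseteq> W" and \<gamma>_0: "\<gamma> 0 = 0"
    and \<gamma>_singular: "\<gamma> ` J \<subseteq> singular_set f"
    and transversal: "d\<Phi> 0 (vderiv \<gamma> 0) $ 1 \<noteq> 0"
begin

lemma \<gamma>_derivative: "t \<in> J \<Longrightarrow> (\<gamma> has_vector_derivative vderiv \<gamma> t) (at t)"
  using smooth_on_vderiv(2)[OF smooth_\<gamma> J(1)] .

lemma \<Phi>_\<gamma>_derivative:
  assumes "t \<in> J"
  shows "((\<lambda>t. \<Phi> (\<gamma> t) $ i) has_vector_derivative d\<Phi> (\<gamma> t) (vderiv \<gamma> t) $ i) (at t)"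
proof -
  have W: "\<gamma> t \<in> W" using assms \<gamma>_W by blast
  have "((\<lambda>t. \<Phi> (\<gamma> t)) has_derivative (\<lambda>h. d\<Phi> (\<gamma> t) (h *\<^sub>R vderiv \<gamma> t))) (at t)"
    by (rule has_derivative_compose[OF \<gamma>_derivative[OF assms, unfolded has_vector_derivative_def] \<Phi>_derivative[OF W]])
  from has_derivative_vec_nth[OF this, of i] show ?thesis
    by (simp add: has_vector_derivative_def linear_scale[OF linear_d\<Phi>[OF W]])
qed

lemma smooth_\<Phi>_\<gamma>: "smooth_on J (\<lambda>t. \<Phi> (\<gamma> t))"
  by (rule smooth_on_compose[OF J(1) open_W smooth_\<Phi> smooth_\<gamma> \<gamma>_W])

text \<open>The expression is the derivative of the smooth function
  \<open>\<Phi> (\<gamma> t) $ 1\<close>.\<close>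

lemma isCont_speed: "isCont (\<lambda>t. d\<Phi> (\<gamma> t) (vderiv \<gamma> t) $ 1) 0"
proof -
  let ?a = "\<lambda>t. \<Phi> (\<gamma> t) $ 1"
  have "vderiv ?a t = d\<Phi> (\<gamma> t) (vderiv \<gamma> t) $ 1" if "t \<in> J" for t
    unfolding vderiv_def[of ?a] by (rule vector_derivative_at[OF \<Phi>_\<gamma>_derivative[OF that]])
  then have "continuous_on J (\<lambda>t. d\<Phi> (\<gamma> t) (vderiv \<gamma> t) $ 1)"
    using smooth_on_continuous_on[OF smooth_on_vderiv(1)[OF smooth_on_nth[OF J(1) smooth_\<Phi>_\<gamma>] J(1)], of 1]
    by (simp cong: continuous_on_cong)
  then show ?thesis using J continuous_on_eq_continuous_at by blast
qed

lemma eventually_first_coordinate: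
  "\<forall>\<^sub>F t in at 0. sgn (\<Phi> (\<gamma> t) $ 1) = sgn t * sgn (d\<Phi> 0 (vderiv \<gamma> 0) $ 1)"
proof -
  let ?s = "d\<Phi> 0 (vderiv \<gamma> 0) $ 1"
  have "((\<lambda>t. (1 / t) *\<^sub>R (\<Phi> (\<gamma> t) $ 1 - \<Phi> (\<gamma> 0) $ 1)) \<longlongrightarrow> ?s) (at 0)"
    using has_vector_derivative_quotient[OF \<Phi>_\<gamma>_derivative[OF J(2), of 1]] by (simp add: \<gamma>_0)
  \<comment> \<open>Multiplying by the limit itself makes the limit a positive square, which treats
    both signs of the speed at once.\<close>
  then have "((\<lambda>t. ?s * (\<Phi> (\<gamma> t) $ 1 / t)) \<longlongrightarrow> ?s * ?s) (at 0)"
    by (intro tendsto_intros) (simp add: \<gamma>_0 \<Phi>_0)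
  moreover have "?s * ?s > 0" using transversal by (simp add: zero_less_mult_iff) linarith
  ultimately have "\<forall>\<^sub>F t in at 0. ?s * (\<Phi> (\<gamma> t) $ 1 / t) > 0" by (rule order_tendstoD)
  then show ?thesis
    by eventually_elim (auto simp: zero_less_mult_iff zero_less_divide_iff divide_less_0_iff mult_less_0_iff sgn_if split: if_splits)
qed

text \<open>For small nonzero \<open>t\<close> the first coordinate is nonzero, while the product of
  both vanishes on the singular set.\<close>

lemma second_coordinate_zero:
  obtains d where "d > 0" "{-d<..<d} \<subseteq> J" "\<And>t. t \<in> {-d<..<d} \<Longrightarrow> \<Phi> (\<gamma> t) $ 2 = 0"
proof -
  have "\<forall>\<^sub>F t in at 0. t \<in> J" using J by (simp add: eventually_at_in_open')
  with eventually_first_coordinate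
  have "\<forall>\<^sub>F t in at 0. t \<in> J \<and> sgn (\<Phi> (\<gamma> t) $ 1) = sgn t * sgn (d\<Phi> 0 (vderiv \<gamma> 0) $ 1)"
    by eventually_elim simp
  then obtain d where d: "d > 0" "\<And>t. t \<noteq> 0 \<Longrightarrow> \<bar>t\<bar> < d \<Longrightarrow>
      t \<in> J \<and> sgn (\<Phi> (\<gamma> t) $ 1) = sgn t * sgn (d\<Phi> 0 (vderiv \<gamma> 0) $ 1)"
    unfolding eventually_at by auto
  have "t \<in> J \<and> \<Phi> (\<gamma> t) $ 2 = 0" if "t \<in> {-d<..<d}" for t
  proof (cases "t = 0")
    case True
    then show ?thesis using J \<gamma>_0 \<Phi>_0 by simp
  next
    case False
    then have t: "t \<in> J" "sgn (\<Phi> (\<gamma> t) $ 1) = sgn t * sgn (d\<Phi> 0 (vderiv \<gamma> 0) $ 1)"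
      using d(2)[of t] that by auto
    then have "\<Phi> (\<gamma> t) $ 1 \<noteq> 0" using False transversal by (auto simp: sgn_zero_iff)
    moreover have "\<Phi> (\<gamma> t) $ 1 * \<Phi> (\<gamma> t) $ 2 = 0"
      using singular_zero t(1) \<gamma>_W \<gamma>_singular by blast
    ultimately show ?thesis using t(1) by simp
  qed
  then show ?thesis using d(1) by (intro that[of d]) auto
qed

text \<open>By \<open>jac_det\<close>, positivity of the frame forces the sign of \<open>jac\<close>
  to be that of the speed \<open>a'\<close> times that of the second coordinate differential on the
  null vector. In the derivative of the area density these signs cancel in pairs, leaving the signs
  of \<open>t\<close> and \<open>\<Delta> 0\<close>. The value is thus the same for every null
  field, which makes the definite description in \<open>singular_curvature\<close> evaluate.\<close>

lemma singular_curvature_value: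
  "\<forall>\<^sub>F t in at 0. singular_curvature f \<nu> \<gamma> t = sgn t * sgn (\<Delta> 0) *
     (det3 (vderiv (f \<circ> \<gamma>) t) ((vderiv ^^ 2) (f \<circ> \<gamma>) t) (\<nu> (\<gamma> t)) / norm (vderiv (f \<circ> \<gamma>) t) ^ 3)"
proof -
  obtain d where d: "d > 0" "{-d<..<d} \<subseteq> J" "\<And>t. t \<in> {-d<..<d} \<Longrightarrow> \<Phi> (\<gamma> t) $ 2 = 0"
    using second_coordinate_zero by blast
  define s where "s = d\<Phi> 0 (vderiv \<gamma> 0) $ 1"
  define a' where "a' = (\<lambda>t. d\<Phi> (\<gamma> t) (vderiv \<gamma> t) $ 1)"
  have a'0: "a' 0 = s" by (simp add: a'_def s_def \<gamma>_0)
  have s: "s \<noteq> 0" using transversal by (simp add: s_def)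
  \<comment> \<open>The neighbourhood includes \<open>t = 0\<close>: one null field is built on all
    of the open set \<open>J'\<close>.\<close>
  have a'_pos: "\<forall>\<^sub>F t in nhds 0. s * a' t > 0"
  proof -
    have "((\<lambda>t. s * a' t) \<longlongrightarrow> s * s) (nhds 0)"
      using isCont_speed a'0 unfolding a'_def[symmetric]
      by (auto simp: isCont_def tendsto_at_iff_tendsto_nhds intro!: tendsto_intros)
    moreover have "s * s > 0" using s by (simp add: zero_less_mult_iff) linarith
    ultimately show ?thesis by (rule order_tendstoD)
  qed
  have "\<forall>\<^sub>F t in nhds 0. t \<in> {-d<..<d}" using d(1) by (intro eventually_nhds_in_open) auto
  with a'_pos have "\<forall>\<^sub>F t in nhds 0. s * a' t > 0 \<and> t \<in> {-d<..<d}" by eventually_elim simp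
  then obtain J' where J': "open J'" "0 \<in> J'" and J'2: "\<And>t. t \<in> J' \<Longrightarrow> s * a' t > 0 \<and> t \<in> {-d<..<d}"
    unfolding eventually_nhds by blast
  have J'J: "J' \<subseteq> J" using J'2 d(2) by blast
  have J'W: "\<gamma> t \<in> W" if "t \<in> J'" for t using that J'J \<gamma>_W by blast
  have second: "d\<Phi> (\<gamma> t) (vderiv \<gamma> t) $ 2 = 0" if "t \<in> J'" for t
  proof -
    have "((\<lambda>t. \<Phi> (\<gamma> t) $ 2) has_derivative (\<lambda>h. h *\<^sub>R (d\<Phi> (\<gamma> t) (vderiv \<gamma> t) $ 2))) (at t)"
      using \<Phi>_\<gamma>_derivative[of t 2] that J'J unfolding has_vector_derivative_def by blast
    then have "((\<lambda>t. 0) has_derivative (\<lambda>h. h *\<^sub>R (d\<Phi> (\<gamma> t) (vderiv \<gamma> t) $ 2))) (at t)"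
      by (rule has_derivative_transform_within_open[OF _ J'(1) that]) (use J'2 d(3) in blast)
    then have "(\<lambda>h. h *\<^sub>R (d\<Phi> (\<gamma> t) (vderiv \<gamma> t) $ 2)) = (\<lambda>h. 0)"
      using has_derivative_const has_derivative_unique by blast
    then have "1 *\<^sub>R (d\<Phi> (\<gamma> t) (vderiv \<gamma> t) $ 2) = 0" by (rule fun_cong)
    then show ?thesis by simp
  qed
  \<comment> \<open>The gradient of the first coordinate turned by a right angle spans the kernel of
    its differential. The sign of \<open>s\<close> makes the determinant with the velocity of
    \<gamma> equal to \<open>sgn s * a' t\<close>, which is positive.\<close>
  define \<eta> :: "real \<Rightarrow> real^2" where
    "\<eta> = (\<lambda>t. vector [- sgn s * d\<Phi> (\<gamma> t) (axis 2 1) $ 1, sgn s * d\<Phi> (\<gamma> t) (axis 1 1) $ 1])"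
  have null: "null_field_along f \<gamma> J' \<eta>"
    unfolding null_field_along_def
  proof (intro conjI ballI)
    have sm: "smooth_on J' (\<lambda>t. d\<Phi> (\<gamma> t) v)" for v
      unfolding d\<Phi>_def
      by (rule smooth_on_compose[OF J'(1) open_W smooth_on_frechet_derivative[OF smooth_\<Phi>]
            smooth_on_subset[OF smooth_\<gamma> J'J]]) (use J'W in blast)
    show "smooth_on J' \<eta>" unfolding \<eta>_def
      by (intro smooth_on_vector2 smooth_on_mult smooth_on_nth smooth_on_const sm J')
    fix t assume t: "t \<in> J'"
    have "a' t = vderiv \<gamma> t $ 1 * d\<Phi> (\<gamma> t) (axis 1 1) $ 1 + vderiv \<gamma> t $ 2 * d\<Phi> (\<gamma> t) (axis 2 1) $ 1"
      unfolding a'_def d\<Phi>_expand[OF J'W[OF t], of "vderiv \<gamma> t"] by simp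
    then have "det2 (vderiv \<gamma> t) (\<eta> t) = sgn s * a' t"
      by (simp add: det2_expand \<eta>_def algebra_simps)
    then show pos: "det2 (vderiv \<gamma> t) (\<eta> t) > 0"
      using J'2[OF t] by (auto simp: sgn_if zero_less_mult_iff split: if_splits)
    then show "\<eta> t \<noteq> 0" by (auto simp: det2_expand)
    have "d\<Phi> (\<gamma> t) (\<eta> t) $ 1 = 0"
      unfolding d\<Phi>_expand[OF J'W[OF t], of "\<eta> t"] by (simp add: \<eta>_def)
    then show "frechet_derivative f (at (\<gamma> t)) (\<eta> t) = 0"
      using d(3) J'2[OF t] by (simp add: f_frechet[OF J'W[OF t]])
  qed
  have "isCont (\<lambda>t. \<Delta> (\<gamma> t)) 0"
  proof (rule isCont_o2[where f=\<gamma> and g=\<Delta>])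
    show "isCont \<gamma> 0" using \<gamma>_derivative[OF J(2)] by (rule has_vector_derivative_continuous)
    show "isCont \<Delta> (\<gamma> 0)" using isCont_\<Delta>[OF zero_W] by (simp add: \<gamma>_0)
  qed
  then have "((\<lambda>t. \<Delta> 0 * \<Delta> (\<gamma> t)) \<longlongrightarrow> \<Delta> 0 * \<Delta> 0) (at 0)"
    by (intro tendsto_intros) (simp add: isCont_def \<gamma>_0)
  moreover have "\<Delta> 0 * \<Delta> 0 > 0" using \<Delta>_nonzero by (simp add: zero_less_mult_iff) linarith
  ultimately have "\<forall>\<^sub>F t in at 0. \<Delta> 0 * \<Delta> (\<gamma> t) > 0" by (rule order_tendstoD)
  moreover have "\<forall>\<^sub>F t in at 0. t \<in> J'" using J' by (simp add: eventually_at_in_open')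
  ultimately show ?thesis
    using eventually_first_coordinate
  proof eventually_elim
    case (elim t)
    let ?R = "det3 (vderiv (f \<circ> \<gamma>) t) ((vderiv ^^ 2) (f \<circ> \<gamma>) t) (\<nu> (\<gamma> t)) / norm (vderiv (f \<circ> \<gamma>) t) ^ 3"
    have W: "\<gamma> t \<in> W" using J'W elim by blast
    have \<Delta>_sgn: "sgn (\<Delta> (\<gamma> t)) = sgn (\<Delta> 0)" and a'_sgn: "sgn (a' t) = sgn s"
      using elim J'2[of t] by (auto simp: sgn_if zero_less_mult_iff)
    \<comment> \<open>Stated for an arbitrary positively oriented field, so that it serves both for
      the existence and for the uniqueness of the value.\<close>
    have wrt: "singular_curvature_wrt f \<nu> \<gamma> \<zeta> t = sgn t * sgn (\<Delta> 0) * ?R"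
      if "det2 (vderiv \<gamma> t) (\<zeta> t) > 0" for \<zeta>
    proof -
      have z: "jac (\<gamma> t) * det2 (vderiv \<gamma> t) (\<zeta> t) = a' t * d\<Phi> (\<gamma> t) (\<zeta> t) $ 2"
        using second elim by (simp add: jac_det[OF W] a'_def)
      have "sgn (jac (\<gamma> t)) * sgn (det2 (vderiv \<gamma> t) (\<zeta> t)) = sgn (a' t) * sgn (d\<Phi> (\<gamma> t) (\<zeta> t) $ 2)"
        using arg_cong[OF z, of sgn] by (simp only: sgn_mult)
      then have "sgn (jac (\<gamma> t)) = sgn s * sgn (d\<Phi> (\<gamma> t) (\<zeta> t) $ 2)"
        using that a'_sgn by simp
      moreover have "frechet_derivative (signed_area_density f \<nu>) (at (\<gamma> t)) (\<zeta> t)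
          = \<Phi> (\<gamma> t) $ 1 * jac (\<gamma> t) * \<Delta> (\<gamma> t) * d\<Phi> (\<gamma> t) (\<zeta> t) $ 2"
        by (rule signed_area_density_derivative[OF W]) (use d(3) J'2 elim in blast)
      moreover have "sgn (jac (\<gamma> t)) * sgn (jac (\<gamma> t)) = 1"
        using jac_nonzero[OF W] by (simp add: sgn_if)
      ultimately have "sgn (frechet_derivative (signed_area_density f \<nu>) (at (\<gamma> t)) (\<zeta> t)) = sgn t * sgn (\<Delta> 0)"
        using elim(3) \<Delta>_sgn by (simp add: sgn_mult s_def[symmetric] mult_ac)
      then show ?thesis by (simp add: singular_curvature_wrt_def)
    qed
    show ?case unfolding singular_curvature_def
    proof (rule the_equality)
      show "\<exists>J \<eta>. open J \<and> t \<in> J \<and> null_field_along f \<gamma> J \<eta> \<and>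
          sgn t * sgn (\<Delta> 0) * ?R = singular_curvature_wrt f \<nu> \<gamma> \<eta> t"
        using null wrt[of \<eta>] J' elim unfolding null_field_along_def by metis
      show "k = sgn t * sgn (\<Delta> 0) * ?R"
        if "\<exists>J \<eta>. open J \<and> t \<in> J \<and> null_field_along f \<gamma> J \<eta> \<and> k = singular_curvature_wrt f \<nu> \<gamma> \<eta> t" for k
        using that wrt unfolding null_field_along_def by metis
    qed
  qed
qed

lemma singular_curvature_diverges:
  assumes f: "smooth_on W f"
    and D: "det3 ((vderiv ^^ 2) (f \<circ> \<gamma>) 0) ((vderiv ^^ 3) (f \<circ> \<gamma>) 0) (\<nu> 0) \<noteq> 0"
  shows "filterlim (singular_curvature f \<nu> \<gamma>) at_top (at_right 0) \<and>
      filterlim (singular_curvature f \<nu> \<gamma>) at_bot (at_left 0) \<or>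
    filterlim (singular_curvature f \<nu> \<gamma>) at_bot (at_right 0) \<and>
      filterlim (singular_curvature f \<nu> \<gamma>) at_top (at_left 0)"
proof -
  let ?D = "det3 ((vderiv ^^ 2) (f \<circ> \<gamma>) 0) ((vderiv ^^ 3) (f \<circ> \<gamma>) 0) (\<nu> 0)"
  let ?R = "\<lambda>t. det3 (vderiv (f \<circ> \<gamma>) t) ((vderiv ^^ 2) (f \<circ> \<gamma>) t) (\<nu> (\<gamma> t)) / norm (vderiv (f \<circ> \<gamma>) t) ^ 3"
  have sm: "smooth_on J (f \<circ> \<gamma>)"
    using smooth_on_compose[OF J(1) open_W f smooth_\<gamma> \<gamma>_W] by (simp add: comp_def)
  \<comment> \<open>Both coordinates vanish at the origin, so the derivative of \<open>f\<close>
    there is zero and the image curve starts with zero velocity.\<close>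
  have "((\<lambda>t. f (\<gamma> t)) has_derivative (\<lambda>h. 0)) (at 0)"
  proof -
    have "(f has_derivative (\<lambda>X. 0)) (at (\<gamma> 0))"
      using f_derivative[OF zero_W] by (simp add: \<Phi>_0 \<gamma>_0)
    from has_derivative_compose[OF \<gamma>_derivative[OF J(2), unfolded has_vector_derivative_def] this]
    show ?thesis .
  qed
  then have v0: "vderiv (f \<circ> \<gamma>) 0 = 0"
    unfolding vderiv_def by (intro vector_derivative_at) (simp add: has_vector_derivative_def comp_def)
  have n: "isCont (\<lambda>t. \<nu> (\<gamma> t)) 0"
  proof (rule isCont_o2[where f=\<gamma> and g=\<nu>])
    show "isCont \<gamma> 0" using \<gamma>_derivative[OF J(2)] by (rule has_vector_derivative_continuous)
    show "isCont \<nu> (\<gamma> 0)"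
      using cont_\<nu> zero_W by (simp add: continuous_on_eq_continuous_at[OF open_W] \<gamma>_0)
  qed
  have g2: "(vderiv ^^ 2) (f \<circ> \<gamma>) 0 \<noteq> 0" using D by (auto simp: det3_expand)
  have lim: "((\<lambda>t. \<bar>t\<bar> * ?R t) \<longlongrightarrow> ?D / (2 * norm ((vderiv ^^ 2) (f \<circ> \<gamma>) 0) ^ 3)) (at 0)"
    using curvature_quotient_limit[OF J sm v0 n] D by (simp add: \<gamma>_0)
  show ?thesis
  proof (rule filterlim_pole_of_order_one_cases)
    show "((\<lambda>t. sgn (\<Delta> 0) * (\<bar>t\<bar> * ?R t)) \<longlongrightarrow>
        sgn (\<Delta> 0) * (?D / (2 * norm ((vderiv ^^ 2) (f \<circ> \<gamma>) 0) ^ 3))) (at 0)"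
      by (intro tendsto_intros lim)
    show "sgn (\<Delta> 0) * (?D / (2 * norm ((vderiv ^^ 2) (f \<circ> \<gamma>) 0) ^ 3)) \<noteq> 0"
      using D g2 \<Delta>_nonzero by (simp add: sgn_zero_iff)
    have "\<forall>\<^sub>F t in at 0. t \<noteq> (0::real)" by (simp add: eventually_at_filter)
    with singular_curvature_value
    show "\<forall>\<^sub>F t in at 0. singular_curvature f \<nu> \<gamma> t = sgn (\<Delta> 0) * (\<bar>t\<bar> * ?R t) * inverse t"
    proof eventually_elim
      case (elim t)
      \<comment> \<open>The sign change at 0 combines with the unsigned blow-up into an odd pole
        \<open>1 / t\<close>.\<close>
      have "sgn t = \<bar>t\<bar> * inverse t" using elim(2) by (simp add: sgn_if)
      then show ?case using elim(1) by (simp only: mult_ac)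
    qed
  qed
qed

end

end

text \<open>Handles a curve tangentially not contained in the zero set of the first coordinate; the
  other case follows by exchanging coordinates. All germs are first represented on one open set
  \<open>W\<close>.\<close>

lemma separated_front_conclusion:
  fixes f \<nu> :: "real^2 \<Rightarrow> real^3" and \<gamma> :: "real \<Rightarrow> real^2"
  assumes f0: "f 0 = 0"
    and S: "diffeo_germ S" and T: "diffeo_germ T"
    and eq: "\<forall>\<^sub>F x in nhds 0. D4_plus_separated_form (S x) = T (f x)"
    and front: "front_with_normal f \<nu>"
    and I: "open I" "0 \<in> I" and \<gamma>: "smooth_on I \<gamma>" "\<gamma> 0 = 0" "\<gamma> ` I \<subseteq> singular_set f"
    and tr: "frechet_derivative S (at 0) (vderiv \<gamma> 0) $ 1 \<noteq> 0"
    and D: "det3 ((vderiv ^^ 2) (f \<circ> \<gamma>) 0) ((vderiv ^^ 3) (f \<circ> \<gamma>) 0) (\<nu> 0) \<noteq> 0"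
  shows "(\<forall>\<^sub>F t in at 0. cuspidal_edge_at f (\<gamma> t)) \<and>
    ((filterlim (singular_curvature f \<nu> \<gamma>) at_top (at_right 0) \<and>
      filterlim (singular_curvature f \<nu> \<gamma>) at_bot (at_left 0)) \<or>
     (filterlim (singular_curvature f \<nu> \<gamma>) at_bot (at_right 0) \<and>
      filterlim (singular_curvature f \<nu> \<gamma>) at_top (at_left 0)))"
proof -
  obtain U where U: "open U" "0 \<in> U" "smooth_on U f" "smooth_on U \<nu>"
    "\<And>p. p \<in> U \<Longrightarrow> norm (\<nu> p) = 1" "\<And>p X. p \<in> U \<Longrightarrow> frechet_derivative f (at p) X \<bullet> \<nu> p = 0"
    using front unfolding front_with_normal_def by blast
  have S0: "S 0 = 0" "diffeo_at S 0" and T0: "T 0 = 0" "diffeo_at T 0"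
    using S T by (simp_all add: diffeo_germ_iff)
  obtain US VS S' where US: "open US" "open VS" "0 \<in> US" "smooth_on US S" "smooth_on VS S'"
    "S ` US \<subseteq> VS" "S' ` VS \<subseteq> US" "\<And>x. x \<in> US \<Longrightarrow> S' (S x) = x" "\<And>y. y \<in> VS \<Longrightarrow> S (S' y) = y"
    by (rule diffeo_atE[OF S0(2)]) blast
  obtain UT VT T' where UT: "open UT" "open VT" "0 \<in> UT" "smooth_on UT T" "smooth_on VT T'"
    "T ` UT \<subseteq> VT" "T' ` VT \<subseteq> UT" "\<And>x. x \<in> UT \<Longrightarrow> T' (T x) = x" "\<And>y. y \<in> VT \<Longrightarrow> T (T' y) = y"
    by (rule diffeo_atE[OF T0(2)]) blast
  obtain N where N: "open N" "0 \<in> N" "\<And>x. x \<in> N \<Longrightarrow> D4_plus_separated_form (S x) = T (f x)"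
    using eq unfolding eventually_nhds by blast
  define W where "W = U \<inter> f -` UT \<inter> US \<inter> N"
  have oW: "open W" unfolding W_def
    using U US UT N by (intro open_Int continuous_open_preimage smooth_on_continuous_on)
  have W0: "0 \<in> W" using U US UT N f0 by (simp add: W_def)
  have sub: "W \<subseteq> U" "W \<subseteq> US" "W \<subseteq> N" "f ` W \<subseteq> UT" by (auto simp: W_def)
  interpret separated_front f \<nu> S T' W VT
  proof
    show "D4_plus_separated_form (S x) \<in> VT" "f x = T' (D4_plus_separated_form (S x))" if "x \<in> W" for x
      using N(3)[of x] UT(6) UT(8)[of "f x"] that sub by (auto simp: image_subset_iff)
    show "X = 0" if "x \<in> W" "frechet_derivative S (at x) X = 0" for x X
      by (rule inj_frechet_derivative_left_inverse[OF US(1) _ US(4,5) _ US(8) that(2)])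
        (use that sub US(6) in blast)+
    \<comment> \<open>Here the roles are reversed: \<open>T\<close> is the left inverse of
      \<open>T'\<close>.\<close>
    show "X = 0" if "y \<in> VT" "frechet_derivative T' (at y) X = 0" for y X
      by (rule inj_frechet_derivative_left_inverse[OF UT(2) that(1) UT(5,4) _ UT(9) that(2)])
        (use that UT(7) in blast)
    show "continuous_on W \<nu>"
      using smooth_on_continuous_on[OF U(4)] sub(1) by (rule continuous_on_subset)
    show "smooth_on W S" using US(4) sub(2) by (rule smooth_on_subset)
  qed (use oW W0 UT(2,5) S0(1) U(5,6) sub(1) in auto)
  have fW: "smooth_on W f" using U(3) sub(1) by (rule smooth_on_subset)
  define J where "J = I \<inter> \<gamma> -` W"
  have J: "open J" "0 \<in> J" unfolding J_def
    using I \<gamma>(2) W0 by (auto intro!: continuous_open_preimage smooth_on_continuous_on \<gamma>(1) oW)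
  have \<gamma>J: "smooth_on J \<gamma>" "\<gamma> ` J \<subseteq> W" "\<gamma> ` J \<subseteq> singular_set f"
    using \<gamma> smooth_on_subset[OF \<gamma>(1), of J] by (auto simp: J_def)
  have tr': "d\<Phi> 0 (vderiv \<gamma> 0) $ 1 \<noteq> 0" using tr by (simp add: d\<Phi>_def)
  note curve = J \<gamma>J(1,2) \<gamma>(2) \<gamma>J(3) tr'
  obtain d where d: "d > 0" "{-d<..<d} \<subseteq> J" "\<And>t. t \<in> {-d<..<d} \<Longrightarrow> S (\<gamma> t) $ 2 = 0"
    using second_coordinate_zero[OF curve] by blast
  have "isCont \<gamma> 0" using J \<gamma>J(1) smooth_on_continuous_on continuous_on_eq_continuous_at by blast
  then have lim: "filterlim \<gamma> (nhds 0) (at 0)" by (simp add: isCont_def \<gamma>(2))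
  have "isCont f 0" using U smooth_on_continuous_on continuous_on_eq_continuous_at by blast
  then have limf: "filterlim f (nhds 0) (nhds 0)" 
    using tendsto_at_iff_tendsto_nhds[of f 0] by (simp add: isCont_def f0)
  \<comment> \<open>An identity of germs at 0 is also one of germs at every nearby point, as
    required for the local statement at \<open>\<gamma> t\<close>.\<close>
  have "\<forall>\<^sub>F x in nhds 0. diffeo_at S x \<and> diffeo_at T (f x) \<and>
      (\<forall>\<^sub>F y in nhds x. D4_plus_separated_form (S y) = T (f y)) \<and> x \<in> W"
    using eventually_diffeo_at[OF S0(2)] eventually_compose_filterlim[OF eventually_diffeo_at[OF T0(2)] limf]
      eq eventually_nhds_in_open[OF oW W0]
    by (simp add: eventually_conj_iff eventually_eventually)
  from eventually_compose_filterlim[OF this lim]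
  have "\<forall>\<^sub>F t in at 0. diffeo_at S (\<gamma> t) \<and> diffeo_at T (f (\<gamma> t)) \<and>
      (\<forall>\<^sub>F y in nhds (\<gamma> t). D4_plus_separated_form (S y) = T (f y)) \<and> \<gamma> t \<in> W" .
  moreover have "\<forall>\<^sub>F t in at 0. t \<in> {-d<..<d}"
    using d(1) by (intro eventually_at_in_open') auto
  moreover have "\<forall>\<^sub>F t in at 0. t \<noteq> (0::real)" by (simp add: eventually_at_filter)
  ultimately have "\<forall>\<^sub>F t in at 0. cuspidal_edge_at f (\<gamma> t)"
    using eventually_first_coordinate[OF curve]
  proof eventually_elim
    case (elim t)
    have "S (\<gamma> t) $ 1 \<noteq> 0" using elim(3,4) tr' by (auto simp: sgn_zero_iff)
    then show ?case
      using elim d(3) by (intro cuspidal_edge_at_of_separated[OF oW _ fW]) auto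
  qed
  moreover note singular_curvature_diverges[OF curve fW D]
  ultimately show ?thesis by blast
qed

section \<open>Reduction of both branches of the singular set to one\<close>

theorem proposition6p1:
  fixes f \<nu> :: "real^2 \<Rightarrow> real^3" and \<gamma> :: "real \<Rightarrow> real^2" and \<epsilon> :: real
  assumes "D4_plus f"
    and "front_with_normal f \<nu>"
    and "\<epsilon> > 0"
    and "smooth_on {-\<epsilon><..<\<epsilon>} \<gamma>"
    and "\<gamma> 0 = 0"
    and "\<And>t. t \<in> {-\<epsilon><..<\<epsilon>} \<Longrightarrow> vderiv \<gamma> t \<noteq> 0"
    and "\<gamma> ` {-\<epsilon><..<\<epsilon>} \<subseteq> singular_set f"
    and "det3 ((vderiv ^^ 2) (f \<circ> \<gamma>) 0) ((vderiv ^^ 3) (f \<circ> \<gamma>) 0) (\<nu> 0) \<noteq> 0"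
  shows "(\<forall>\<^sub>F t in at 0. cuspidal_edge_at f (\<gamma> t)) \<and>
    ((filterlim (singular_curvature f \<nu> \<gamma>) at_top (at_right 0) \<and>
      filterlim (singular_curvature f \<nu> \<gamma>) at_bot (at_left 0)) \<or>
     (filterlim (singular_curvature f \<nu> \<gamma>) at_bot (at_right 0) \<and>
      filterlim (singular_curvature f \<nu> \<gamma>) at_top (at_left 0)))"
proof -
  have f0: "f 0 = 0" using assms(1) by (simp add: D4_plus_def map_germ_def)
  obtain S T where ST: "diffeo_germ S" "diffeo_germ T"
    "\<forall>\<^sub>F x in nhds 0. D4_plus_separated_form (S x) = T (f x)"
    using D4_plus_separated[OF assms(1)] by blast
  have I: "open {-\<epsilon><..<\<epsilon>}" "0 \<in> {-\<epsilon><..<\<epsilon>}" using assms(3) by auto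
  note rest = assms(2) I assms(4,5,7)
  have "diffeo_at S 0" using ST(1) by (simp add: diffeo_germ_iff)
  then obtain U V S' where U: "open U" "open V" "0 \<in> U" "smooth_on U S" "smooth_on V S'"
    "S ` U \<subseteq> V" "S' ` V \<subseteq> U" "\<And>x. x \<in> U \<Longrightarrow> S' (S x) = x" "\<And>y. y \<in> V \<Longrightarrow> S (S' y) = y"
    by (rule diffeo_atE) blast
  \<comment> \<open>Regularity of \<gamma> at 0 survives the coordinate change, so at least one
    coordinate has nonzero speed.\<close>
  have "frechet_derivative S (at 0) (vderiv \<gamma> 0) \<noteq> 0"
    using inj_frechet_derivative_left_inverse[OF U(1,3,4,5) _ U(8), of "vderiv \<gamma> 0"] U(3,6) assms(6)[OF I(2)]
    by blast
  then consider "frechet_derivative S (at 0) (vderiv \<gamma> 0) $ 1 \<noteq> 0" | "frechet_derivative S (at 0) (vderiv \<gamma> 0) $ 2 \<noteq> 0"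
    by (auto simp: vec_eq_iff forall_2)
  then show ?thesis
  proof cases
    case 1
    then show ?thesis by (rule separated_front_conclusion[OF f0 ST rest _ assms(8)])
  next
    case 2
    \<comment> \<open>Exchanging the two variables of the separated form exchanges the squares and
      negates the difference of cubes; \<open>M\<close> is this linear map of the target.\<close>
    define L :: "real^2 \<Rightarrow> real^2" where "L = (\<lambda>x. vector [x$2, x$1])"
    define M :: "real^3 \<Rightarrow> real^3" where "M = (\<lambda>x. vector [x$2, x$1, - x$3])"
    have L: "bounded_linear L"
      unfolding L_def by (intro linear_vector2 linearI) simp_all
    have "diffeo_germ L"
      by (rule diffeo_germ_linear[OF L L]) (simp_all add: L_def vec_eq_iff forall_2)
    then have S: "diffeo_germ (\<lambda>x. L (S x))" by (rule diffeo_germ_compose[OF ST(1)])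
    have M: "bounded_linear M" unfolding M_def by (rule linear_vector3) (auto intro!: linearI)
    have "diffeo_germ M"
      by (rule diffeo_germ_linear[OF M M]) (simp_all add: M_def vec_eq_iff forall_3)
    then have T: "diffeo_germ (\<lambda>x. M (T x))" by (rule diffeo_germ_compose[OF ST(2)])
    have "D4_plus_separated_form (L x) = M (D4_plus_separated_form x)" for x
      by (simp add: D4_plus_separated_form_def L_def M_def)
    then have eq: "\<forall>\<^sub>F x in nhds 0. D4_plus_separated_form (L (S x)) = M (T (f x))"
      using ST(3) by (auto elim: eventually_mono)
    have "((\<lambda>x. L (S x)) has_derivative (\<lambda>X. L (frechet_derivative S (at 0) X))) (at 0)"
      by (rule bounded_linear.has_derivative[OF L smooth_on_has_derivative[OF U(4,3)]])
    then have "frechet_derivative (\<lambda>x. L (S x)) (at 0) (vderiv \<gamma> 0) $ 1 \<noteq> 0"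
      using 2 by (simp add: frechet_derivative_at[symmetric] L_def)
    then show ?thesis by (rule separated_front_conclusion[OF f0 S T eq rest _ assms(8)])
  qed
qed

end
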